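(* Let $Z=[z_1,\dots,z_r]\in\mathbb{C}^{n\times r}$ be the matrix and $a\in\mathbb{C}^{(k+1)\times(k+1)\times r}$ the coefficient tensor that represent the tensor structured function $$\Psi_{k+1}(\theta)=P_k(\theta)\Big(\sum_{\ell=1}^r a_{:,:,\ell}\otimes z_\ell\Big),$$ and let $\underline{H}_k\in\mathbb{C}^{(k+1)\times k}$ be such that $(\Psi_{k+1},\underline{H}_k)$ is a TIAR factorization. Assume that the first column $\psi_1(\theta)$ of $\Psi_{k+1}(\theta)$ is a constant function, i.e. $a_{i,1,\ell}=0$ whenever $i>1$. Then $$\|a_{i,:,:}\|\le\frac{C}{(i-1)!}\qquad\text{for } i=1,\dots,k+1,$$ where $C=\kappa\big([v,\;C_{k+1}v,\;\dots,\;C_{k+1}^{k}v]\big)$, $v=\sum_{\ell=1}^r a_{:,1,\ell}\otimes z_\ell\in\mathbb{C}^{(k+1)n}$, and $C_{k+1}$ is the companion matrix given in the context.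
   Context: Setting: $\Omega\subseteq\mathbb{C}$ is an open disk centered at the origin, $M:\Omega\to\mathbb{C}^{n\times n}$ is analytic, $M_i:=M^{(i)}(0)$, and $M_0=M(0)$ is invertible (zero is not an eigenvalue). Put $B(\lambda)=M(0)^{-1}(M(0)-M(\lambda))/\lambda$, extended analytically to $\lambda=0$. The linear operator $\mathcal{B}$ acts on analytic functions $\psi:\mathbb{C}\to\mathbb{C}^n$ (for which the series converges) by $$\mathcal{B}\psi(\theta)=\int_0^\theta\psi(\hat\theta)\,d\hat\theta+\sum_{i=0}^\infty\frac{B^{(i)}(0)}{i!}\psi^{(i)}(0),$$ and columnwise on matrix-valued functions. Notation: $P_d(\theta):=(1,\theta,\dots,\theta^d)\otimes I_n\in\mathbb{C}^{n\times(d+1)n}$; $\otimes$ is the Kronecker product; colons denote slices of tensors, so $a_{i,:,:}$ is a $(k+1)\times r$ matrix and $a_{:,:,\ell}$ a $(k+1)\times(k+1)$ matrix. The columns of $Z$ are orthonormal. The scalar product of $\psi(\theta)=\sum_i\theta^ix_i$ and $\varphi(\theta)=\sum_i\theta^iy_i$ is $\langle\psi,\varphi\rangle=\sum_i x_i^Hy_i$; a matrix-valued function is called orthogonal if its columns are orthonormal in this scalar product. $\|\cdot\|$ is the spectral norm of matrices and $\kappa$ the corresponding condition number (largest over smallest singular value). TIAR factorization: a pair $(\Psi_{k+1},\underline{H}_k)$ where $\Psi_{k+1}$ is a tensor structured function with $k+1$ orthonormal columns, $\underline{H}_k\in\mathbb{C}^{(k+1)\times k}$ is an upper Hessenberg matrix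 with positive subdiagonal elements, and $\mathcal{B}\Psi_k(\theta)=\Psi_{k+1}(\theta)\underline{H}_k$, with $\Psi_k$ the first $k$ columns of $\Psi_{k+1}$. The companion matrix $C_{N}\in\mathbb{C}^{Nn\times Nn}$ (with $N\times N$ blocks of size $n\times n$) has first block row $-M_0^{-1}\big[M_1,\ \tfrac{1}{2}M_2,\ \dots,\ \tfrac1N M_N\big]$, its block in position $(i+1,i)$ is $\tfrac1i I_n$ for $i=1,\dots,N-1$, and all other blocks are zero. (It represents the action of $\mathcal{B}$ on stacked monomial coefficient vectors of polynomials of degree at most $N-2$.) *)

theory Defs
  imports "HOL-Complex_Analysis.Complex_Analysis" "Jordan_Normal_Form.Schur_Decomposition"
begin

no_notation vec_nth (infixl \<open>$\<close> 90)
no_notation inner (infix \<open>\<bullet>\<close> 70)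
hide_const (open) Finite_Cartesian_Product.vec Finite_Cartesian_Product.row
  Finite_Cartesian_Product.mat

text \<open>
  Vectors and matrices have run-time dimensions, because block sizes such as \<open>(k + 1) * n\<close> depend
  on the number of steps. All indices, including those of coefficient tensors
  \<open>a :: nat \<Rightarrow> nat \<Rightarrow> nat \<Rightarrow> complex\<close>, start at 0; entries of \<open>a\<close> outside the intended ranges
  are never used.
\<close>


section \<open>Matrix norms, condition number, Kronecker product\<close>

definition vnorm :: "complex vec \<Rightarrow> real" where
  "vnorm x = L2_set (\<lambda>i. cmod (x $ i)) {..<dim_vec x}"

definition spectral_norm :: "complex mat \<Rightarrow> real" where
  "spectral_norm A = (SUP x\<in>{x \<in> carrier_vec (dim_col A). vnorm x \<le> 1}. vnorm (A *\<^sub>v x))"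

text \<open>
  The case distinction chooses the smaller Gram matrix, so that exactly the \<open>min m n\<close> singular
  values of an \<open>m \<times> n\<close> matrix are listed, without the spurious zeros of the larger one.
  The eigenvalues in question are real and nonnegative.
\<close>

definition singular_values :: "complex mat \<Rightarrow> real set" where
  "singular_values A =
     (let G = (if dim_col A \<le> dim_row A then mat_adjoint A * A else A * mat_adjoint A)
      in {sqrt (Re e) | e. eigenvalue G e})"

text \<open>
  For a rank-deficient matrix this is \<open>0\<close> rather than infinite, by the convention \<open>x / 0 = 0\<close>.
  The columns of the Krylov matrix of a TIAR factorization with constant first column are
  linearly independent, so this case does not arise there.
\<close>

definition cond_number :: "complex mat \<Rightarrow> real" where
  "cond_number A = Max (singular_values A) / Min (singular_values A)"

definition kron :: "complex mat \<Rightarrow> complex mat \<Rightarrow> complex mat" where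
  "kron A B = mat (dim_row A * dim_row B) (dim_col A * dim_col B)
     (\<lambda>(i, j). A $$ (i div dim_row B, j div dim_col B) * B $$ (i mod dim_row B, j mod dim_col B))"

definition kron_vec :: "complex vec \<Rightarrow> complex vec \<Rightarrow> complex vec" where
  "kron_vec x y = vec (dim_vec x * dim_vec y) (\<lambda>i. x $ (i div dim_vec y) * y $ (i mod dim_vec y))"

definition orthonormal_cols :: "complex mat \<Rightarrow> bool" where
  "orthonormal_cols A \<longleftrightarrow> mat_adjoint A * A = 1\<^sub>m (dim_col A)"

definition upper_hessenberg :: "complex mat \<Rightarrow> bool" where
  "upper_hessenberg H \<longleftrightarrow> (\<forall>i < dim_row H. \<forall>j < dim_col H. j + 1 < i \<longrightarrow> H $$ (i, j) = 0)"

definition first_cols :: "nat \<Rightarrow> complex mat \<Rightarrow> complex mat" where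
  "first_cols k A = mat (dim_row A) k (\<lambda>(i, j). A $$ (i, j))"


section \<open>Vector- and matrix-valued analytic functions\<close>

definition mat_analytic_on :: "nat \<Rightarrow> (complex \<Rightarrow> complex mat) \<Rightarrow> complex set \<Rightarrow> bool" where
  "mat_analytic_on n M S \<longleftrightarrow>
     (\<forall>z\<in>S. M z \<in> carrier_mat n n) \<and>
     (\<forall>p<n. \<forall>q<n. (\<lambda>z. M z $$ (p, q)) analytic_on S)"

definition mat_deriv :: "nat \<Rightarrow> (complex \<Rightarrow> complex mat) \<Rightarrow> complex \<Rightarrow> complex mat" where
  "mat_deriv i F z = mat (dim_row (F z)) (dim_col (F z))
     (\<lambda>(p, q). (deriv ^^ i) (\<lambda>w. F w $$ (p, q)) z)"

definition vec_deriv :: "nat \<Rightarrow> (complex \<Rightarrow> complex vec) \<Rightarrow> complex \<Rightarrow> complex vec" where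
  "vec_deriv i \<psi> z = vec (dim_vec (\<psi> z)) (\<lambda>p. (deriv ^^ i) (\<lambda>w. \<psi> w $ p) z)"

definition taylor_coeff :: "(complex \<Rightarrow> complex vec) \<Rightarrow> nat \<Rightarrow> complex vec" where
  "taylor_coeff \<psi> i = (1 / fact i) \<cdot>\<^sub>v vec_deriv i \<psi> 0"

text \<open>The scalar product is conjugate-linear in its first argument, whereas \<open>x \<bullet>c y\<close> conjugates \<open>y\<close>.\<close>

definition fun_inner :: "(complex \<Rightarrow> complex vec) \<Rightarrow> (complex \<Rightarrow> complex vec) \<Rightarrow> complex" where
  "fun_inner \<psi> \<phi> = (\<Sum>i. taylor_coeff \<phi> i \<bullet>c taylor_coeff \<psi> i)"

definition orthogonal_fun :: "nat \<Rightarrow> (complex \<Rightarrow> complex mat) \<Rightarrow> bool" where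
  "orthogonal_fun m \<Psi> \<longleftrightarrow>
     (\<forall>i<m. \<forall>j<m. fun_inner (\<lambda>\<theta>. col (\<Psi> \<theta>) i) (\<lambda>\<theta>. col (\<Psi> \<theta>) j) = (if i = j then 1 else 0))"


section \<open>The operator of the nonlinear eigenvalue problem\<close>

definition minv :: "complex mat \<Rightarrow> complex mat" where
  "minv A = the (mat_inverse A)"

text \<open>
  The quotient has a removable singularity at \<open>0\<close>; \<open>remove_sings\<close> extends it
  analytically there and does not change it elsewhere in the domain of \<open>M\<close>.
\<close>

definition nep_B :: "(complex \<Rightarrow> complex mat) \<Rightarrow> complex \<Rightarrow> complex mat" where
  "nep_B M z = mat (dim_row (M 0)) (dim_row (M 0))
     (\<lambda>(p, q). remove_sings (\<lambda>w. (minv (M 0) * (M 0 - M w)) $$ (p, q) / w) z)"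

text \<open>
  The value is meaningful only where the series converges. The functions to which the operator is
  applied below are polynomials, for which only finitely many terms are nonzero.
\<close>

definition nep_op ::
  "(complex \<Rightarrow> complex mat) \<Rightarrow> (complex \<Rightarrow> complex vec) \<Rightarrow> complex \<Rightarrow> complex vec" where
  "nep_op M \<psi> \<theta> = vec (dim_row (M 0))
     (\<lambda>p. contour_integral (linepath 0 \<theta>) (\<lambda>t. \<psi> t $ p) +
          (\<Sum>i. (((1 / fact i) \<cdot>\<^sub>m mat_deriv i (nep_B M) 0) *\<^sub>v vec_deriv i \<psi> 0) $ p))"

definition nep_op_cols ::
  "(complex \<Rightarrow> complex mat) \<Rightarrow> (complex \<Rightarrow> complex mat) \<Rightarrow> complex \<Rightarrow> complex mat" where
  "nep_op_cols M \<Psi> \<theta> = mat_of_cols (dim_row (M 0))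
     (map (\<lambda>j. nep_op M (\<lambda>t. col (\<Psi> t) j) \<theta>) [0..<dim_col (\<Psi> \<theta>)])"

text \<open>
  With block indices starting at 0, the block in position \<open>(i, i - 1)\<close> is \<open>1/i\<close> times the
  identity, and the block in position \<open>(0, j)\<close> involves the derivative of order \<open>j + 1\<close>.
\<close>

definition companion :: "(complex \<Rightarrow> complex mat) \<Rightarrow> nat \<Rightarrow> complex mat" where
  "companion M N = (let n = dim_row (M 0) in
     mat (N * n) (N * n) (\<lambda>(p, q).
       let bi = p div n; bj = q div n; s = p mod n; t = q mod n in
       if bi = 0 then
         (- (minv (M 0) * ((1 / of_nat (bj + 1)) \<cdot>\<^sub>m mat_deriv (bj + 1) M 0))) $$ (s, t)
       else if bi = bj + 1 then ((1 / of_nat bi) \<cdot>\<^sub>m 1\<^sub>m n) $$ (s, t)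
       else 0))"

definition krylov_mat :: "complex mat \<Rightarrow> complex vec \<Rightarrow> nat \<Rightarrow> complex mat" where
  "krylov_mat A v k = mat_of_cols (dim_vec v) (map (\<lambda>j. (A ^\<^sub>m j) *\<^sub>v v) [0..<k + 1])"


section \<open>Tensor structured functions and TIAR factorizations\<close>

definition monomial_mat :: "nat \<Rightarrow> nat \<Rightarrow> complex \<Rightarrow> complex mat" where
  "monomial_mat n d \<theta> = kron (mat 1 (d + 1) (\<lambda>(_, j). \<theta> ^ j)) (1\<^sub>m n)"

definition slice_first :: "nat \<Rightarrow> nat \<Rightarrow> (nat \<Rightarrow> nat \<Rightarrow> nat \<Rightarrow> complex) \<Rightarrow> nat \<Rightarrow> complex mat" where
  "slice_first k r a i = mat (k + 1) r (\<lambda>(j, l). a i j l)"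

definition slice_third :: "nat \<Rightarrow> (nat \<Rightarrow> nat \<Rightarrow> nat \<Rightarrow> complex) \<Rightarrow> nat \<Rightarrow> complex mat" where
  "slice_third k a l = mat (k + 1) (k + 1) (\<lambda>(i, j). a i j l)"

text \<open>\<open>tensor_coeffs\<close> is the sum of the Kronecker products of \<open>slice_third k a l\<close> and column \<open>l\<close> of \<open>Z\<close>.\<close>

definition tensor_coeffs ::
  "nat \<Rightarrow> complex mat \<Rightarrow> (nat \<Rightarrow> nat \<Rightarrow> nat \<Rightarrow> complex) \<Rightarrow> complex mat" where
  "tensor_coeffs k Z a = mat ((k + 1) * dim_row Z) (k + 1)
     (\<lambda>(p, q). \<Sum>l<dim_col Z.
        kron (slice_third k a l) (mat_of_cols (dim_row Z) [col Z l]) $$ (p, q))"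

definition tensor_fun ::
  "nat \<Rightarrow> complex mat \<Rightarrow> (nat \<Rightarrow> nat \<Rightarrow> nat \<Rightarrow> complex) \<Rightarrow> complex \<Rightarrow> complex mat" where
  "tensor_fun k Z a \<theta> = monomial_mat (dim_row Z) k \<theta> * tensor_coeffs k Z a"

definition tensor_start_vec ::
  "nat \<Rightarrow> complex mat \<Rightarrow> (nat \<Rightarrow> nat \<Rightarrow> nat \<Rightarrow> complex) \<Rightarrow> complex vec" where
  "tensor_start_vec k Z a = vec ((k + 1) * dim_row Z)
     (\<lambda>p. \<Sum>l<dim_col Z. kron_vec (vec (k + 1) (\<lambda>i. a i 0 l)) (col Z l) $ p)"

definition tensor_structured :: "nat \<Rightarrow> nat \<Rightarrow> (complex \<Rightarrow> complex mat) \<Rightarrow> bool" where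
  "tensor_structured n k \<Psi> \<longleftrightarrow>
     (\<exists>r Z a. Z \<in> carrier_mat n r \<and> orthonormal_cols Z \<and> \<Psi> = tensor_fun k Z a)"

definition tiar_factorization ::
  "(complex \<Rightarrow> complex mat) \<Rightarrow> nat \<Rightarrow> (complex \<Rightarrow> complex mat) \<Rightarrow> complex mat \<Rightarrow> bool" where
  "tiar_factorization M k \<Psi> H \<longleftrightarrow>
     tensor_structured (dim_row (M 0)) k \<Psi> \<and>
     orthogonal_fun (k + 1) \<Psi> \<and>
     H \<in> carrier_mat (k + 1) k \<and>
     upper_hessenberg H \<and>
     (\<forall>j<k. H $$ (j + 1, j) \<in> \<real> \<and> 0 < Re (H $$ (j + 1, j))) \<and>
     (\<forall>\<theta>. nep_op_cols M (\<lambda>t. first_cols k (\<Psi> t)) \<theta> = \<Psi> \<theta> * H)"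

end

theory Submission
  imports Defs "Jordan_Normal_Form.Spectral_Radius"
begin

text \<open>
  Let \<open>V\<close> be the matrix of monomial coefficients of the tensor structured function, \<open>C\<close> the
  companion matrix, \<open>K = [v, C v, \<dots>, C\<^sup>k v]\<close>, and \<open>B\<^sub>i\<close> the \<open>i\<close>-th block row of a matrix \<open>B\<close>,
  so that \<open>V\<^sub>i\<close> collects the coefficients of \<open>\<theta>\<^sup>i\<close>.

  Orthogonality of the function says that \<open>V\<close> has orthonormal columns
  (\<open>orthonormal_coeffs\<close>), and comparing the coefficients of \<open>\<theta>\<close> in the factorization turns it into
  the Arnoldi relation \<open>C V\<^sub>k = V H\<close> for the first \<open>k\<close> columns \<open>V\<^sub>k\<close> (\<open>companion_hessenberg\<close>).
  Since the subdiagonal of \<open>H\<close> is nonzero, that relation can be solved for the columns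
  of \<open>V\<close> one after the other, which yields \<open>V = K W\<close> (\<open>hessenberg_krylov_factor\<close>). In particular
  \<open>K\<close> is injective, so that all its singular values are positive.

  The decay comes from the companion matrix. Below the first block row it only shifts blocks
  down, dividing by the block index. Because \<open>v\<close> is supported in block \<open>0\<close>, the row
  \<open>K\<^sub>i\<close> is \<open>1/i!\<close> times the row \<open>K\<^sub>0\<close> shifted by \<open>i\<close> columns (\<open>krylov_block_entry\<close>). If \<open>z'\<close> is the
  correspondingly shifted \<open>z\<close>, then \<open>\<parallel>z'\<parallel> \<le> \<parallel>z\<parallel>\<close>, and the condition number bounds how differently
  \<open>K\<close> can stretch the two vectors (\<open>cond_number_stretch_ratio\<close>):
  \<open>\<parallel>K\<^sub>i z\<parallel> = \<parallel>K\<^sub>0 z'\<parallel> / i! \<le> \<parallel>K z'\<parallel> / i! \<le> \<kappa>(K) \<parallel>K z\<parallel> / i!\<close>.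
  For \<open>z = W y\<close> this reads \<open>\<parallel>V\<^sub>i y\<parallel> \<le> \<kappa>(K) \<parallel>V y\<parallel> / i! = \<kappa>(K) \<parallel>y\<parallel> / i!\<close>.

  Finally \<open>V\<^sub>i = Z a\<^sub>i\<^sup>T\<close> for the slice \<open>a\<^sub>i\<close>, and \<open>Z\<close> is an isometry, so the bound holds for \<open>a\<^sub>i\<^sup>T\<close> and
  hence for \<open>a\<^sub>i\<close>.
\<close>

no_notation fps_nth (infixl \<open>$\<close> 75)


section \<open>Extremal singular values\<close>

lemma vnorm_nonneg: "0 \<le> vnorm x"
  by (simp add: vnorm_def)

lemma vnorm_sq: "(vnorm x)\<^sup>2 = (\<Sum>i<dim_vec x. (cmod (x $ i))\<^sup>2)"
  by (simp add: vnorm_def L2_set_def sum_nonneg)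

lemma cscalar_self: "x \<bullet>c x = complex_of_real ((vnorm x)\<^sup>2)"
  unfolding vnorm_sq scalar_prod_def
  by (auto simp: complex_norm_square atLeast0LessThan simp del: of_real_power intro!: sum.cong)

lemma vnorm_eq_0_iff: "x \<in> carrier_vec N \<Longrightarrow> vnorm x = 0 \<longleftrightarrow> x = 0\<^sub>v N"
  by (auto simp: vnorm_def L2_set_eq_0_iff)

lemma vnorm_smult: "vnorm (c \<cdot>\<^sub>v x) = cmod c * vnorm x"
  by (auto simp: vnorm_def L2_set_right_distrib norm_mult intro!: L2_set_cong)

lemma dim_mat_adjoint [simp]:
  "dim_row (mat_adjoint A) = dim_col A" "dim_col (mat_adjoint A) = dim_row A"
  by (auto simp: mat_adjoint_def)

lemma mat_adjoint_carrier [simp]: "A \<in> carrier_mat m N \<Longrightarrow> mat_adjoint A \<in> carrier_mat N m"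
  by (intro carrier_matI) auto

lemma index_mat_adjoint:
  "i < dim_col A \<Longrightarrow> j < dim_row A \<Longrightarrow> mat_adjoint A $$ (i, j) = conjugate (A $$ (j, i))"
  by (simp add: mat_adjoint_def mat_of_rows_index)

lemma cscalar_mult_mat_vec:
  fixes A :: "complex mat"
  assumes "A \<in> carrier_mat m N" "x \<in> carrier_vec N" "y \<in> carrier_vec m"
  shows "(A *\<^sub>v x) \<bullet>c y = x \<bullet>c (mat_adjoint A *\<^sub>v y)"
proof -
  have "(A *\<^sub>v x) \<bullet>c y = (\<Sum>i<m. \<Sum>j<N. A $$ (i, j) * x $ j * cnj (y $ i))"
    using assms by (simp add: scalar_prod_def atLeast0LessThan sum_distrib_right)
  also have "\<dots> = (\<Sum>j<N. \<Sum>i<m. A $$ (i, j) * x $ j * cnj (y $ i))"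
    by (rule sum.swap)
  also have "\<dots> = x \<bullet>c (mat_adjoint A *\<^sub>v y)"
    using assms by (simp add: scalar_prod_def atLeast0LessThan sum_distrib_left index_mat_adjoint
        mult_ac)
  finally show ?thesis .
qed

lemma vnorm_isometry:
  assumes "orthonormal_cols V" "V \<in> carrier_mat m N" "x \<in> carrier_vec N"
  shows "vnorm (V *\<^sub>v x) = vnorm x"
proof -
  have "complex_of_real ((vnorm (V *\<^sub>v x))\<^sup>2) = (V *\<^sub>v x) \<bullet>c (V *\<^sub>v x)"
    by (rule cscalar_self [symmetric])
  also have "\<dots> = x \<bullet>c ((mat_adjoint V * V) *\<^sub>v x)"
    using assms(2,3) by (subst cscalar_mult_mat_vec[OF assms(2,3)])
        (auto simp: assoc_mult_mat_vec[of _ N m _ N])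
  also have "\<dots> = complex_of_real ((vnorm x)\<^sup>2)"
    using assms by (simp add: orthonormal_cols_def cscalar_self)
  finally show ?thesis
    using vnorm_nonneg by (simp add: of_real_eq_iff flip: of_real_power)
qed

text \<open>
  Vectors of run-time dimension carry no topology, so compactness is taken from the product
  topology on functions: extended by zero, the unit sphere is a closed subset of a product of
  compact discs and points.
\<close>

lemma unit_sphere_attains_inf:
  fixes F :: "complex vec \<Rightarrow> real"
  assumes "0 < N" and cont: "continuous_on UNIV (\<lambda>f :: nat \<Rightarrow> complex. F (vec N f))"
  shows "\<exists>u\<in>carrier_vec N. vnorm u = 1 \<and> (\<forall>x\<in>carrier_vec N. vnorm x = 1 \<longrightarrow> F u \<le> F x)"
proof -
  define box :: "(nat \<Rightarrow> complex) set" where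
    "box = PiE UNIV (\<lambda>i. if i < N then cball 0 1 else {0})"
  define S where "S = box \<inter> {f. (\<Sum>i<N. (cmod (f i))\<^sup>2) = 1}"
  have coord: "continuous_on UNIV (\<lambda>f :: nat \<Rightarrow> complex. f i)" for i
    by (rule continuous_on_product_coordinates)
  have "compactin (product_topology (\<lambda>i. euclidean) UNIV) box"
    unfolding box_def compactin_PiE by auto
  then have "compact box"
    by (simp add: euclidean_product_topology)
  moreover have "closed {f :: nat \<Rightarrow> complex. (\<Sum>i<N. (cmod (f i))\<^sup>2) = 1}"
    by (intro closed_Collect_eq continuous_intros coord)
  ultimately have "compact S"
    unfolding S_def by (rule compact_Int_closed)
  moreover have "(\<lambda>i. if i = 0 then 1 else 0) \<in> S"
    using \<open>0 < N\<close> by (auto simp: S_def box_def if_distrib if_distribR cong: if_cong)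
  then have "S \<noteq> {}" by blast
  moreover have "continuous_on S (\<lambda>f. F (vec N f))"
    using cont continuous_on_subset by blast
  ultimately obtain f where f: "f \<in> S" "\<forall>g\<in>S. F (vec N f) \<le> F (vec N g)"
    using continuous_attains_inf by blast
  have norm1: "vnorm x = 1 \<longleftrightarrow> (\<Sum>i<N. (cmod (x $ i))\<^sup>2) = 1" if "x \<in> carrier_vec N" for x
    using that vnorm_sq[of x] vnorm_nonneg[of x]
      by (metis carrier_vecD one_power2 power2_eq_imp_eq zero_le_one)
  have "F (vec N f) \<le> F x" if x: "x \<in> carrier_vec N" "vnorm x = 1" for x
  proof -
    define g where "g i = (if i < N then x $ i else 0)" for i
    have g: "vec N g = x" using x by (auto simp: g_def)
    have "cmod (x $ i) \<le> 1" if "i < N" for i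
    proof -
      have "(cmod (x $ i))\<^sup>2 \<le> (\<Sum>i<N. (cmod (x $ i))\<^sup>2)"
        using that by (intro member_le_sum) auto
      then show ?thesis
        using x norm1 by (simp add: power_le_one_iff flip: abs_square_le_1)
    qed
    moreover have "(\<Sum>i<N. (cmod (g i))\<^sup>2) = 1"
      using norm1[OF x(1)] x(2) by (simp add: g_def)
    ultimately have "g \<in> S"
      by (auto simp: S_def box_def g_def)
    then show ?thesis using f(2) g by auto
  qed
  moreover have "vnorm (vec N f) = 1"
    using f(1) norm1[of "vec N f"] by (simp add: S_def)
  ultimately show ?thesis by (intro bexI[of _ "vec N f"]) auto
qed

text \<open>
  First variation of the semidefinite form \<open>q\<close> of \<open>s (G - \<mu>)\<close> at a zero \<open>u\<close> of \<open>q\<close>. In the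
  direction \<open>w = G u - \<mu> u\<close> its derivative is a nonzero multiple of \<open>\<parallel>w\<parallel>\<^sup>2\<close>, and it must vanish because \<open>q\<close>
  has an extremum at \<open>u\<close>. The sign \<open>s\<close> covers minima (\<open>s = 1\<close>) and maxima (\<open>s = - 1\<close>) of the Rayleigh
  quotient at once.
\<close>

lemma rayleigh_extremal_eigenvector:
  fixes G :: "complex mat"
  assumes G: "G \<in> carrier_mat N N"
    and herm: "\<And>x y. x \<in> carrier_vec N \<Longrightarrow> y \<in> carrier_vec N \<Longrightarrow> (G *\<^sub>v x) \<bullet>c y = x \<bullet>c (G *\<^sub>v y)"
    and s: "\<bar>s\<bar> = (1 :: real)"
    and ineq: "\<And>x. x \<in> carrier_vec N \<Longrightarrow> 0 \<le> s * (Re ((G *\<^sub>v x) \<bullet>c x) - \<mu> * (vnorm x)\<^sup>2)"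
    and u: "u \<in> carrier_vec N" and eq: "Re ((G *\<^sub>v u) \<bullet>c u) = \<mu> * (vnorm u)\<^sup>2"
  shows "G *\<^sub>v u = complex_of_real \<mu> \<cdot>\<^sub>v u"
proof -
  define A where "A = G + complex_of_real (- \<mu>) \<cdot>\<^sub>m 1\<^sub>m N"
  have A: "A \<in> carrier_mat N N" using G by (simp add: A_def)
  have Ax: "A *\<^sub>v x = G *\<^sub>v x + complex_of_real (- \<mu>) \<cdot>\<^sub>v x" if "x \<in> carrier_vec N" for x
  proof -
    have "(c \<cdot>\<^sub>m 1\<^sub>m N) *\<^sub>v x = c \<cdot>\<^sub>v x" for c
      using that by (intro eq_vecI) auto
    then show ?thesis using that G by (simp add: A_def add_mult_distrib_mat_vec[of _ N N])
  qed
  have Aherm: "(A *\<^sub>v x) \<bullet>c y = x \<bullet>c (A *\<^sub>v y)" if "x \<in> carrier_vec N" "y \<in> carrier_vec N" for x y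
    using that G herm[OF that]
    by (simp add: Ax conjugate_add_vec[of _ N] conjugate_smult_vec add_scalar_prod_distrib[of _ N]
        scalar_prod_add_distrib[of _ N])
  have Aform: "Re ((A *\<^sub>v x) \<bullet>c x) = Re ((G *\<^sub>v x) \<bullet>c x) - \<mu> * (vnorm x)\<^sup>2" if "x \<in> carrier_vec N" for x
    using that G by (simp add: Ax add_scalar_prod_distrib[of _ N] cscalar_self flip: of_real_power
        of_real_mult)
  define w where "w = A *\<^sub>v u"
  have w: "w \<in> carrier_vec N" using A u by (simp add: w_def)
  define q where "q = Re ((A *\<^sub>v w) \<bullet>c w)"
  have expand: "Re ((A *\<^sub>v (u + complex_of_real t \<cdot>\<^sub>v w)) \<bullet>c (u + complex_of_real t \<cdot>\<^sub>v w))
      = 2 * t * (vnorm w)\<^sup>2 + t\<^sup>2 * q" for t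
  proof -
    have "(A *\<^sub>v (u + complex_of_real t \<cdot>\<^sub>v w)) \<bullet>c (u + complex_of_real t \<cdot>\<^sub>v w)
      = (A *\<^sub>v u) \<bullet>c u + complex_of_real t * ((A *\<^sub>v u) \<bullet>c w) + complex_of_real t * ((A *\<^sub>v w) \<bullet>c u)
          + complex_of_real (t^2) * ((A *\<^sub>v w) \<bullet>c w)"
      using A u w
      by (simp add: mult_add_distrib_mat_vec[of _ N N] mult_mat_vec[of _ N N] conjugate_add_vec[of _ N]
          conjugate_smult_vec add_scalar_prod_distrib[of _ N] scalar_prod_add_distrib[of _ N]
              power2_eq_square algebra_simps)
    also have "(A *\<^sub>v u) \<bullet>c w = complex_of_real ((vnorm w)\<^sup>2)"
      by (simp add: w_def[symmetric] cscalar_self)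
    also have "(A *\<^sub>v w) \<bullet>c u = complex_of_real ((vnorm w)\<^sup>2)"
      using Aherm[OF w u] by (simp add: w_def[symmetric] cscalar_self)
    finally show ?thesis
      using Aform[OF u] eq by (simp add: q_def)
  qed
  have pos: "0 \<le> s * (2 * t * (vnorm w)\<^sup>2 + t\<^sup>2 * q)" for t
    using ineq[of "u + complex_of_real t \<cdot>\<^sub>v w"] Aform[of "u + complex_of_real t \<cdot>\<^sub>v w"] expand[of t]
      u w by simp
  have "(vnorm w)\<^sup>2 \<le> 0"
  proof (rule ccontr)
    assume "\<not> (vnorm w)\<^sup>2 \<le> 0"
    then have W: "(vnorm w)\<^sup>2 > 0" by simp
    define W where "W = (vnorm w)\<^sup>2"
    \<comment> \<open>a step so short that the quadratic term cannot compensate the linear one\<close>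
    define t where "t = W / (\<bar>q\<bar> + 1)"
    have t: "t > 0" and tq: "t * (\<bar>q\<bar> + 1) = W" using W by (auto simp: t_def W_def)
    have ss: "s * s = 1" using s by (metis abs_mult_self_eq mult_1)
    have "0 \<le> s * (2 * (- s * t) * W + (- s * t)\<^sup>2 * q)" using pos[of "- s * t"] by (simp add: W_def)
    also have "\<dots> = - 2 * (s * s) * t * W + (s * s) * t\<^sup>2 * (s * q)"
      by (simp add: power2_eq_square algebra_simps)
    also have "\<dots> = t * (- 2 * W + t * (s * q))" using ss by (simp add: power2_eq_square algebra_simps)
    finally have "2 * W \<le> t * (s * q)" using t by (simp add: zero_le_mult_iff)
    also have "s * q \<le> \<bar>q\<bar>" using s by (metis abs_ge_self abs_mult mult_1)
    then have "t * (s * q) \<le> t * (\<bar>q\<bar> + 1)" using t by (intro mult_left_mono) auto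
    finally have "2 * W \<le> W" using tq by simp
    then show False using W by (simp add: W_def)
  qed
  then have "w = 0\<^sub>v N" using vnorm_eq_0_iff[OF w] vnorm_nonneg[of w] by simp
  have 0: "G *\<^sub>v u + complex_of_real (- \<mu>) \<cdot>\<^sub>v u = 0\<^sub>v N"
    using \<open>w = 0\<^sub>v N\<close> Ax[OF u] by (simp add: w_def)
  show ?thesis
  proof (rule eq_vecI)
    fix i assume "i < dim_vec (complex_of_real \<mu> \<cdot>\<^sub>v u)"
    then have "i < N" using u by simp
    with arg_cong[OF 0, of "\<lambda>v :: complex vec. v $ i"] G u
    show "(G *\<^sub>v u) $ i = (complex_of_real \<mu> \<cdot>\<^sub>v u) $ i"
      by simp
  qed (use G u in simp)
qed

lemma gram_form:
  assumes "K \<in> carrier_mat m N" "x \<in> carrier_vec N"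
  shows "((mat_adjoint K * K) *\<^sub>v x) \<bullet>c x = complex_of_real ((vnorm (K *\<^sub>v x))\<^sup>2)"
proof -
  have "mat_adjoint (mat_adjoint K) = K"
    by (intro eq_matI) (auto simp: index_mat_adjoint)
  then show ?thesis
    using assms cscalar_mult_mat_vec[of "mat_adjoint K" N m "K *\<^sub>v x" x]
    by (simp add: assoc_mult_mat_vec[of _ N m _ N] cscalar_self)
qed

text \<open>
  For \<open>s = 1\<close> this is a singular value that bounds \<open>K\<close> from below, for \<open>s = - 1\<close> one that bounds it
  from above. Either is the value of \<open>\<parallel>K u\<parallel>\<close> at an extremal unit vector \<open>u\<close>, which is an
  eigenvector of the Gram matrix.
\<close>

lemma extremal_singular_value:
  assumes K: "K \<in> carrier_mat m N" and N: "0 < N" "N \<le> m" and s: "\<bar>s\<bar> = (1 :: real)"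
  shows "\<exists>\<sigma>\<in>singular_values K. \<forall>x\<in>carrier_vec N. s * (\<sigma> * vnorm x) \<le> s * vnorm (K *\<^sub>v x)"
proof -
  define G where "G = mat_adjoint K * K"
  have G: "G \<in> carrier_mat N N" unfolding G_def
    by (rule mult_carrier_mat[OF mat_adjoint_carrier[OF K] K])
  have "continuous_on UNIV (\<lambda>f :: nat \<Rightarrow> complex. s * vnorm (K *\<^sub>v vec N f))"
    using K unfolding vnorm_def L2_set_def
    by (intro continuous_intros)
       (auto simp: scalar_prod_def intro!: continuous_intros continuous_on_product_coordinates)
  from unit_sphere_attains_inf[OF N(1) this]
  obtain u where u: "u \<in> carrier_vec N" "vnorm u = 1"
    and min: "\<And>x. x \<in> carrier_vec N \<Longrightarrow> vnorm x = 1 \<Longrightarrow> s * vnorm (K *\<^sub>v u) \<le> s * vnorm (K *\<^sub>v x)"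
    by blast
  define \<sigma> where "\<sigma> = vnorm (K *\<^sub>v u)"
  have ext: "s * (\<sigma> * vnorm x) \<le> s * vnorm (K *\<^sub>v x)" if x: "x \<in> carrier_vec N" for x
  proof (cases "vnorm x = 0")
    case True
    then have "x = 0\<^sub>v N" using x vnorm_eq_0_iff by blast
    then have "K *\<^sub>v x = 0\<^sub>v m" using K by auto
    then show ?thesis using True vnorm_eq_0_iff[of "0\<^sub>v m" m] by simp
  next
    case False
    then have p: "vnorm x > 0" using vnorm_nonneg[of x] by linarith
    define y where "y = complex_of_real (1 / vnorm x) \<cdot>\<^sub>v x"
    have y: "y \<in> carrier_vec N" "vnorm y = 1" using x p by (auto simp: y_def vnorm_smult norm_divide)
    have "vnorm (K *\<^sub>v y) = vnorm (K *\<^sub>v x) / vnorm x"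
      using x K p by (simp add: y_def mult_mat_vec[of _ m N] vnorm_smult norm_divide)
    with min[OF y] p show ?thesis by (simp add: \<sigma>_def field_simps)
  qed
  have herm: "(G *\<^sub>v x) \<bullet>c y = x \<bullet>c (G *\<^sub>v y)" if "x \<in> carrier_vec N" "y \<in> carrier_vec N" for x y
  proof -
    have "mat_adjoint G = G"
      using K by (intro eq_matI) (auto simp: G_def index_mat_adjoint scalar_prod_def mult.commute)
    with cscalar_mult_mat_vec[OF G that] show ?thesis by simp
  qed
  have "G *\<^sub>v u = complex_of_real (\<sigma>\<^sup>2) \<cdot>\<^sub>v u"
  proof (rule rayleigh_extremal_eigenvector[OF G herm s _ u(1)])
    fix x :: "complex vec" assume x: "x \<in> carrier_vec N"
    have [simp]: "Re ((G *\<^sub>v x) \<bullet>c x) = (vnorm (K *\<^sub>v x))\<^sup>2"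
      using gram_form[OF K x] by (simp add: G_def)
    have pos: "0 \<le> \<sigma> * vnorm x" "0 \<le> vnorm (K *\<^sub>v x)" by (simp_all add: \<sigma>_def vnorm_nonneg)
    have "s = 1 \<or> s = -1" using s by linarith
    then show "0 \<le> s * (Re ((G *\<^sub>v x) \<bullet>c x) - \<sigma>\<^sup>2 * (vnorm x)\<^sup>2)"
      using ext[OF x] power_mono[OF _ pos(1), of "vnorm (K *\<^sub>v x)" 2] power_mono[OF _ pos(2), of "\<sigma>
          * vnorm x" 2]
      by (auto simp: power_mult_distrib)
  next
    show "Re ((G *\<^sub>v u) \<bullet>c u) = \<sigma>\<^sup>2 * (vnorm u)\<^sup>2"
      using gram_form[OF K u(1)] u(2) by (simp add: G_def \<sigma>_def)
  qed
  moreover have "u \<noteq> 0\<^sub>v N" using u vnorm_eq_0_iff[OF u(1)] by auto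
  ultimately have "eigenvalue G (complex_of_real (\<sigma>\<^sup>2))"
    using u G unfolding eigenvalue_def eigenvector_def by auto
  moreover have "\<sigma> = sqrt (Re (complex_of_real (\<sigma>\<^sup>2)))"
    by (simp add: \<sigma>_def vnorm_nonneg del: of_real_power)
  moreover have "singular_values K = {sqrt (Re e) |e. eigenvalue G e}"
    using K N by (simp add: singular_values_def G_def)
  ultimately have "\<sigma> \<in> singular_values K" by blast
  with ext show ?thesis by blast
qed

lemma finite_singular_values: "finite (singular_values K)"
proof -
  define G where "G = (if dim_col K \<le> dim_row K then mat_adjoint K * K else K * mat_adjoint K)"
  have "G \<in> carrier_mat (dim_row G) (dim_row G)" by (auto simp: G_def)
  then have "finite (Collect (eigenvalue G))"
    using card_finite_spectrum(1) unfolding spectrum_def by blast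
  moreover have "singular_values K = (\<lambda>e. sqrt (Re e)) ` Collect (eigenvalue G)"
    by (auto simp: singular_values_def Let_def G_def)
  ultimately show ?thesis by simp
qed

lemma singular_value_pos:
  assumes K: "K \<in> carrier_mat m N" and "N \<le> m"
    and inj: "\<And>x. x \<in> carrier_vec N \<Longrightarrow> K *\<^sub>v x = 0\<^sub>v m \<Longrightarrow> x = 0\<^sub>v N"
    and "\<sigma> \<in> singular_values K"
  shows "0 < \<sigma>"
proof -
  obtain e where \<sigma>: "\<sigma> = sqrt (Re e)" and "eigenvalue (mat_adjoint K * K) e"
    using assms unfolding singular_values_def by (auto simp: Let_def)
  then obtain x where x: "x \<in> carrier_vec N" "x \<noteq> 0\<^sub>v N" "(mat_adjoint K * K) *\<^sub>v x = e \<cdot>\<^sub>v x"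
    using K unfolding eigenvalue_def eigenvector_def by auto
  have "complex_of_real ((vnorm (K *\<^sub>v x))\<^sup>2) = e * complex_of_real ((vnorm x)\<^sup>2)"
    using gram_form[OF K x(1)] x(1) by (simp add: x(3) cscalar_self)
  then have "Re (complex_of_real ((vnorm (K *\<^sub>v x))\<^sup>2)) = Re (e * complex_of_real ((vnorm x)\<^sup>2))"
    by (rule arg_cong)
  then have "(vnorm (K *\<^sub>v x))\<^sup>2 = Re e * (vnorm x)\<^sup>2"
    by (simp del: of_real_power)
  moreover have "vnorm (K *\<^sub>v x) \<noteq> 0"
    using inj[OF x(1)] x(1,2) K vnorm_eq_0_iff[of "K *\<^sub>v x" m] by auto
  ultimately have "0 < Re e * (vnorm x)\<^sup>2" by (metis zero_less_power2)
  then have "0 < Re e" by (simp add: zero_less_mult_iff)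
  then show ?thesis by (simp add: \<sigma>)
qed

text \<open>
  The largest singular value bounds \<open>\<parallel>K y\<parallel>\<close> from above, the smallest one bounds \<open>\<parallel>K x\<parallel>\<close> from below.
  Injectivity excludes the singular value \<open>0\<close>, for which the condition number has a default value.
\<close>

lemma cond_number_stretch_ratio:
  assumes K: "K \<in> carrier_mat m N" and N: "0 < N" "N \<le> m"
    and inj: "\<And>x. x \<in> carrier_vec N \<Longrightarrow> K *\<^sub>v x = 0\<^sub>v m \<Longrightarrow> x = 0\<^sub>v N"
    and x: "x \<in> carrier_vec N" and y: "y \<in> carrier_vec N" and "vnorm y \<le> vnorm x"
  shows "vnorm (K *\<^sub>v y) \<le> cond_number K * vnorm (K *\<^sub>v x)"
proof -
  obtain \<sigma> where \<sigma>: "\<sigma> \<in> singular_values K" "\<sigma> * vnorm x \<le> vnorm (K *\<^sub>v x)"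
    using extremal_singular_value[OF K N, of 1] x by auto
  obtain \<tau> where \<tau>: "\<tau> \<in> singular_values K" "vnorm (K *\<^sub>v y) \<le> \<tau> * vnorm y"
    using extremal_singular_value[OF K N, of "-1"] y by auto
  let ?min = "Min (singular_values K)" and ?max = "Max (singular_values K)"
  have "?min \<in> singular_values K" using \<sigma>(1) finite_singular_values by (intro Min_in) auto
  then have min: "0 < ?min" using singular_value_pos[OF K N(2) inj] by blast
  have "vnorm (K *\<^sub>v y) \<le> ?max * vnorm x"
    using \<tau> assms(7) singular_value_pos[OF K N(2) inj \<tau>(1)] Max_ge[OF finite_singular_values \<tau>(1)]
        vnorm_nonneg
    by (meson mult_mono order_trans less_imp_le)
  also have "\<dots> = cond_number K * (?min * vnorm x)" using min by (simp add: cond_number_def)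
  also have "\<dots> \<le> cond_number K * vnorm (K *\<^sub>v x)"
  proof (rule mult_left_mono)
    show "?min * vnorm x \<le> vnorm (K *\<^sub>v x)"
      using \<sigma> Min_le[OF finite_singular_values \<sigma>(1)] vnorm_nonneg[of x]
        by (meson mult_right_mono order_trans)
    show "0 \<le> cond_number K"
      using min Max_ge[OF finite_singular_values \<sigma>(1)] Min_le[OF finite_singular_values \<sigma>(1)]
      unfolding cond_number_def by (intro divide_nonneg_pos) auto
  qed
  finally show ?thesis .
qed


section \<open>Coefficients of polynomial vector functions\<close>

lemma sum_blocks:
  fixes f :: "nat \<Rightarrow> 'a :: comm_monoid_add"
  shows "(\<Sum>t<N * n. f t) = (\<Sum>i<N. \<Sum>p<n. f (i * n + p))"
proof -
  have "(\<Sum>t<N * n. f t) = (\<Sum>i<N. sum f {i * n..<i * n + n})"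
    by (rule sum.nat_group [symmetric])
  also have "\<dots> = (\<Sum>i<N. \<Sum>p<n. f (i * n + p))"
  proof (rule sum.cong)
    show "sum f {i * n..<i * n + n} = (\<Sum>p<n. f (i * n + p))" for i
      using sum.shift_bounds_nat_ivl[of f 0 "i * n" n] by (simp add: atLeast0LessThan add.commute)
  qed simp
  finally show ?thesis .
qed

lemma block_index_less: "i \<le> k \<Longrightarrow> p < n \<Longrightarrow> i * n + p < (k + 1) * (n :: nat)"
  using mult_le_mono1[of i k n] by (simp add: trans_less_add1 add.commute add_less_le_mono)

lemma block_index_cases:
  assumes "t < (k + 1) * (n :: nat)"
  obtains i p where "i \<le> k" "p < n" "t = i * n + p"
proof
  show "t div n \<le> k" using assms by (metis Suc_eq_plus1 less_Suc_eq_le less_mult_imp_div_less)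
  show "t mod n < n" using assms by (metis mod_less_divisor mult_0_right not_less_zero gr_zeroI)
  show "t = t div n * n + t mod n" by simp
qed

lemma tensor_coeffs_carrier: "tensor_coeffs k Z a \<in> carrier_mat ((k + 1) * dim_row Z) (k + 1)"
  by (simp add: tensor_coeffs_def)

lemma index_tensor_coeffs:
  assumes "Z \<in> carrier_mat n r" "i \<le> k" "p < n" "q \<le> k"
  shows "tensor_coeffs k Z a $$ (i * n + p, q) = (\<Sum>l<r. a i q l * Z $$ (p, l))"
  using assms block_index_less[OF assms(2,3)]
  by (auto simp: tensor_coeffs_def kron_def slice_third_def mat_of_cols_index intro!: sum.cong)

lemma tensor_start_vec_eq_col: "tensor_start_vec k Z a = col (tensor_coeffs k Z a) 0"
proof (rule eq_vecI)
  fix t assume "t < dim_vec (col (tensor_coeffs k Z a) 0)"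
  then have "t < (k + 1) * dim_row Z" by (simp add: tensor_coeffs_def)
  then obtain i p where ip: "i \<le> k" "p < dim_row Z" "t = i * dim_row Z + p"
    by (rule block_index_cases)
  then show "tensor_start_vec k Z a $ t = col (tensor_coeffs k Z a) 0 $ t"
    using block_index_less[OF ip(1,2)]
    by (auto simp: tensor_start_vec_def tensor_coeffs_def kron_def kron_vec_def slice_third_def
        mat_of_cols_index intro!: sum.cong)
qed (simp add: tensor_start_vec_def tensor_coeffs_def)

definition entry_poly :: "nat \<Rightarrow> nat \<Rightarrow> complex mat \<Rightarrow> nat \<Rightarrow> nat \<Rightarrow> complex poly" where
  "entry_poly n k V q p = (\<Sum>i\<le>k. monom (V $$ (i * n + p, q)) i)"

lemma coeff_entry_poly:
  "coeff (entry_poly n k V q p) i = (if i \<le> k then V $$ (i * n + p, q) else 0)"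
  by (simp add: entry_poly_def coeff_sum)

lemma degree_entry_poly: "degree (entry_poly n k V q p) \<le> k"
  by (rule degree_le) (simp add: coeff_entry_poly)

lemma col_monomial_mat_mult:
  assumes V: "V \<in> carrier_mat ((k + 1) * n) N" and "q < N"
  shows "col (monomial_mat n k \<theta> * V) q = vec n (\<lambda>p. poly (entry_poly n k V q p) \<theta>)"
proof (rule eq_vecI)
  fix p assume "p < dim_vec (vec n (\<lambda>p. poly (entry_poly n k V q p) \<theta>))"
  then have p: "p < n" by simp
  have dims: "monomial_mat n k \<theta> \<in> carrier_mat n ((k + 1) * n)"
    by (simp add: monomial_mat_def kron_def)
  have entry: "monomial_mat n k \<theta> $$ (p, i * n + s) = (if s = p then \<theta> ^ i else 0)"
      if "i \<le> k" "s < n" for i s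
    using p that block_index_less[OF that] by (simp add: monomial_mat_def kron_def)
  have "col (monomial_mat n k \<theta> * V) q $ p
      = (\<Sum>t<(k + 1) * n. monomial_mat n k \<theta> $$ (p, t) * V $$ (t, q))"
    using p assms dims by (simp add: scalar_prod_def atLeast0LessThan)
  also have "\<dots> = (\<Sum>i<k + 1. \<Sum>s<n. monomial_mat n k \<theta> $$ (p, i * n + s) * V $$ (i * n + s, q))"
    by (rule sum_blocks)
  also have "\<dots> = (\<Sum>i<k + 1. \<Sum>s<n. if s = p then \<theta> ^ i * V $$ (i * n + p, q) else 0)"
    by (intro sum.cong refl) (auto simp: entry)
  also have "\<dots> = poly (entry_poly n k V q p) \<theta>"
    using p by (simp add: entry_poly_def poly_sum poly_monom lessThan_Suc_atMost mult.commute)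
  finally show "col (monomial_mat n k \<theta> * V) q $ p = vec n (\<lambda>p. poly (entry_poly n k V q p) \<theta>) $ p"
    using p by simp
qed (use assms in \<open>simp add: monomial_mat_def kron_def\<close>)

lemma higher_deriv_poly_0: "(deriv ^^ m) (poly P) 0 = fact m * coeff P m" for P :: "complex poly"
proof -
  have "(deriv ^^ m) (poly P) = poly ((pderiv ^^ m) P)"
    by (induction m) (auto intro!: DERIV_imp_deriv poly_DERIV)
  then show ?thesis
    by (simp add: poly_0_coeff_0 coeff_higher_pderiv pochhammer_fact)
qed

lemma vec_deriv_poly:
  "vec_deriv m (\<lambda>\<theta>. vec n (\<lambda>p. poly (P p) \<theta>)) 0 = vec n (\<lambda>p. fact m * coeff (P p) m)"
  by (rule eq_vecI) (simp_all add: vec_deriv_def higher_deriv_poly_0)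

lemma taylor_coeff_poly:
  "taylor_coeff (\<lambda>\<theta>. vec n (\<lambda>p. poly (P p) \<theta>)) m = vec n (\<lambda>p. coeff (P p) m)"
  by (rule eq_vecI) (auto simp: taylor_coeff_def vec_deriv_poly)

lemma fun_inner_poly:
  assumes "\<And>p. p < n \<Longrightarrow> degree (P p) \<le> k"
  shows "fun_inner (\<lambda>\<theta>. vec n (\<lambda>p. poly (P p) \<theta>)) (\<lambda>\<theta>. vec n (\<lambda>p. poly (Q p) \<theta>))
    = (\<Sum>i\<le>k. \<Sum>p<n. coeff (Q p) i * cnj (coeff (P p) i))"
proof -
  have "coeff (P p) i = 0" if "p < n" "\<not> i \<le> k" for p i
    using assms[OF that(1)] that(2) by (intro coeff_eq_0) auto
  then have "(\<Sum>i. \<Sum>p<n. coeff (Q p) i * cnj (coeff (P p) i))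
      = (\<Sum>i\<in>{..k}. \<Sum>p<n. coeff (Q p) i * cnj (coeff (P p) i))"
    by (intro suminf_finite) auto
  then show ?thesis
    by (simp add: fun_inner_def taylor_coeff_poly scalar_prod_def atLeast0LessThan)
qed

text \<open>
  The scalar product of polynomial vector functions is the Euclidean one of their stacked
  coefficients.
\<close>

lemma orthonormal_coeffs:
  assumes V: "V \<in> carrier_mat ((k + 1) * n) N"
    and "orthogonal_fun N (\<lambda>\<theta>. monomial_mat n k \<theta> * V)"
  shows "orthonormal_cols V"
  unfolding orthonormal_cols_def
proof (rule eq_matI)
  fix i j assume "i < dim_row (1\<^sub>m (dim_col V) :: complex mat)" "j < dim_col (1\<^sub>m (dim_col V) ::
      complex mat)"
  then have ij: "i < N" "j < N" using V by auto
  have "(mat_adjoint V * V) $$ (i, j) = (\<Sum>t<(k + 1) * n. cnj (V $$ (t, i)) * V $$ (t, j))"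
    using ij V by (simp add: mat_adjoint_def scalar_prod_def atLeast0LessThan)
  also have "\<dots> = (\<Sum>b<k + 1. \<Sum>p<n. cnj (V $$ (b * n + p, i)) * V $$ (b * n + p, j))"
    by (rule sum_blocks)
  also have "\<dots> = fun_inner (\<lambda>\<theta>. vec n (\<lambda>p. poly (entry_poly n k V i p) \<theta>)) (\<lambda>\<theta>. vec n (\<lambda>p. poly
      (entry_poly n k V j p) \<theta>))"
    by (subst fun_inner_poly[OF degree_entry_poly])
        (simp add: coeff_entry_poly lessThan_Suc_atMost mult.commute)
  also have "\<dots> = (if i = j then 1 else 0)"
    using assms(2) ij by (simp add: orthogonal_fun_def col_monomial_mat_mult[OF V])
  finally show "(mat_adjoint V * V) $$ (i, j) = 1\<^sub>m (dim_col V) $$ (i, j)"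
    using ij V by simp
qed (use V in \<open>auto simp: mat_adjoint_def\<close>)


section \<open>The operator as companion matrix\<close>

text \<open>
  Near \<open>0\<close> the function \<open>g\<close> is the identity times the extension of \<open>g w / w\<close>. In the Leibniz rule
  for the derivative of order \<open>i + 1\<close> of that product only the term with the first derivative of
  the identity survives at \<open>0\<close>.
\<close>

lemma higher_deriv_removed_quotient:
  assumes g: "g analytic_on {0}" and "g 0 = 0"
  shows "(deriv ^^ i) (remove_sings (\<lambda>w. g w / w)) 0 = (deriv ^^ Suc i) g 0 / of_nat (Suc i)"
proof -
  define f where "f w = g w / w" for w :: complex
  define h where "h = remove_sings f"
  have g': "(g has_field_derivative deriv g 0) (at 0)"
    using g by (simp add: analytic_on_imp_differentiable_at DERIV_deriv_iff_field_differentiable)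
  have f0: "f \<midarrow>0\<rightarrow> deriv g 0"
    using g' \<open>g 0 = 0\<close> by (simp add: DERIV_def f_def [abs_def])
  have iso: "isolated_singularity_at f 0"
  proof -
    obtain e where e: "e > 0" "g holomorphic_on ball 0 e"
      using g by (auto simp: analytic_at_ball)
    then have "f holomorphic_on ball 0 e - {0}"
      unfolding f_def by (intro holomorphic_intros holomorphic_on_subset[OF e(2)]) auto
    then show ?thesis using e(1) isolated_singularity_at_holomorphic[of f "ball 0 e" 0] by auto
  qed
  have h: "h analytic_on {0}"
    unfolding h_def using iso f0 by (rule remove_sings_analytic_at)
  have "eventually (\<lambda>w. h w = f w) (at 0)"
    unfolding h_def by (rule eventually_remove_sings_eq_at[OF iso])
  then have "eventually (\<lambda>w. g w = w * h w) (nhds 0)"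
    unfolding eventually_at_filter by eventually_elim (use \<open>g 0 = 0\<close> in \<open>auto simp: f_def\<close>)
  then have "(deriv ^^ Suc i) g 0 = (deriv ^^ Suc i) (\<lambda>w. w * h w) 0"
    by (intro higher_deriv_cong_ev) auto
  also have "\<dots> = (\<Sum>j = 0..Suc i. of_nat (Suc i choose j) * (deriv ^^ j) (\<lambda>w. w) 0
      * (deriv ^^ (Suc i - j)) h 0)"
    by (rule higher_deriv_mult_at[OF _ h]) (rule analytic_on_ident)
  also have "\<dots> = (\<Sum>j = 0..Suc i. if j = 1 then of_nat (Suc i) * (deriv ^^ i) h 0 else 0)"
    by (intro sum.cong refl) auto
  also have "\<dots> = of_nat (Suc i) * (deriv ^^ i) h 0" by simp
  finally show ?thesis by (simp add: h_def f_def [abs_def] del: funpow.simps of_nat_Suc)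
qed

lemma minv_carrier:
  assumes "A \<in> carrier_mat n n" "invertible_mat A"
  shows "minv A \<in> carrier_mat n n"
proof -
  obtain B where B: "A * B = 1\<^sub>m n" "B * A = 1\<^sub>m (dim_row B)"
    using assms unfolding invertible_mat_def inverts_mat_def by auto
  have "dim_col B = n" "dim_row B = n"
    using arg_cong[OF B(1), of dim_col] arg_cong[OF B(2), of dim_col] assms(1) by auto
  then have "A \<in> Units (ring_mat TYPE(complex) n undefined)"
    using assms(1) B by (auto simp: Units_def ring_mat_def intro!: bexI[of _ B])
  then obtain C where "mat_inverse A = Some C"
    using mat_inverse(1)[OF assms(1)] by fastforce
  with mat_inverse(2)[OF assms(1) this] show ?thesis by (simp add: minv_def)
qed

text \<open>
  Two things at once: the derivative of order \<open>i\<close> of \<open>nep_B M\<close> at \<open>0\<close>, and the block in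
  column \<open>i\<close> of the first block row of the companion matrix.
\<close>

definition nep_coeff :: "(complex \<Rightarrow> complex mat) \<Rightarrow> nat \<Rightarrow> complex mat" where
  "nep_coeff M i = - (minv (M 0) * ((1 / of_nat (i + 1)) \<cdot>\<^sub>m mat_deriv (i + 1) M 0))"

lemma higher_deriv_sum_at:
  assumes "finite U" and "\<And>u. u \<in> U \<Longrightarrow> f u analytic_on {z}"
  shows "(deriv ^^ m) (\<lambda>w. \<Sum>u\<in>U. f u w) z = (\<Sum>u\<in>U. (deriv ^^ m) (f u) z)"
  using assms
proof (induction U rule: finite_induct)
  case (insert u U)
  then have "f u analytic_on {z}" "(\<lambda>w. \<Sum>u\<in>U. f u w) analytic_on {z}"
    by (auto intro!: analytic_intros)
  with insert show ?case by (simp add: higher_deriv_add_at)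
qed simp

text \<open>
  The values of \<open>M\<close> outside the disk are arbitrary and may even have other dimensions, so the entries
  of the product \<open>minv (M 0) * (M 0 - M w)\<close> can be expanded only near \<open>0\<close>; neither derivatives nor
  \<open>remove_sings\<close> depend on more than that.
\<close>

lemma mat_deriv_nep_B:
  assumes "0 < \<rho>" and M: "mat_analytic_on n M (ball 0 \<rho>)" and inv: "invertible_mat (M 0)"
    and ps: "p < n" "s < n"
  shows "mat_deriv i (nep_B M) 0 $$ (p, s) = nep_coeff M i $$ (p, s)"
proof -
  have M0: "M 0 \<in> carrier_mat n n" using M \<open>0 < \<rho>\<close> by (simp add: mat_analytic_on_def)
  have inv': "minv (M 0) \<in> carrier_mat n n" by (rule minv_carrier[OF M0 inv])
  define g where "g w = (\<Sum>u<n. minv (M 0) $$ (p, u) * (M 0 $$ (u, s) - M w $$ (u, s)))" for w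
  have an: "(\<lambda>w. M w $$ (u, s)) analytic_on {0}" if "u < n" for u
    using M that ps \<open>0 < \<rho>\<close> analytic_on_subset[of "\<lambda>w. M w $$ (u, s)" "ball 0 \<rho>" "{0}"]
    by (auto simp: mat_analytic_on_def)
  have g: "g analytic_on {0}"
    unfolding g_def using an by (auto intro!: analytic_intros)
  have quot: "eventually (\<lambda>w. (minv (M 0) * (M 0 - M w)) $$ (p, s) / w = g w / w) (nhds 0)"
  proof -
    have "eventually (\<lambda>w. w \<in> ball 0 \<rho>) (nhds (0 :: complex))"
      using \<open>0 < \<rho>\<close> by (intro eventually_nhds_in_open) auto
    then show ?thesis
    proof eventually_elim
      case (elim w)
      then have "M w \<in> carrier_mat n n" using M by (simp add: mat_analytic_on_def)
      then show ?case
        using ps M0 inv' by (simp add: g_def scalar_prod_def atLeast0LessThan)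
    qed
  qed
  have "(deriv ^^ i) (remove_sings (\<lambda>w. (minv (M 0) * (M 0 - M w)) $$ (p, s) / w)) 0
      = (deriv ^^ i) (remove_sings (\<lambda>w. g w / w)) 0"
  proof (rule higher_deriv_cong_ev)
    have "eventually (\<lambda>v. eventually (\<lambda>w. (minv (M 0) * (M 0 - M w)) $$ (p, s) / w = g w / w)
        (nhds v)) (nhds 0)"
      using quot by (simp add: eventually_eventually)
    then show "eventually (\<lambda>v. remove_sings (\<lambda>w. (minv (M 0) * (M 0 - M w)) $$ (p, s) / w) v
        = remove_sings (\<lambda>w. g w / w) v) (nhds 0)"
      by eventually_elim (auto simp: eventually_nhds_conv_at intro: remove_sings_cong)
  qed simp
  also have "\<dots> = (deriv ^^ Suc i) g 0 / of_nat (Suc i)"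
    by (rule higher_deriv_removed_quotient[OF g]) (simp add: g_def)
  also have "(deriv ^^ Suc i) g 0 = (\<Sum>u<n. minv (M 0) $$ (p, u) *
      (- ((deriv ^^ Suc i) (\<lambda>w. M w $$ (u, s)) 0)))"
  proof -
    have *: "(deriv ^^ Suc i) (\<lambda>w. c - M w $$ (u, s)) 0 = - ((deriv ^^ Suc i) (\<lambda>w. M w $$ (u, s)) 0)"
        if "u < n" for u c
      using higher_deriv_diff_at[OF analytic_on_const an[OF that], of "Suc i" c]
      by (simp only: higher_deriv_const) simp
    have "(deriv ^^ Suc i) g 0 = (\<Sum>u<n. (deriv ^^ Suc i)
        (\<lambda>w. minv (M 0) $$ (p, u) * (M 0 $$ (u, s) - M w $$ (u, s))) 0)"
      unfolding g_def by (intro higher_deriv_sum_at) (auto intro!: analytic_intros an)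
    also have "\<dots> = (\<Sum>u<n. minv (M 0) $$ (p, u) * (- ((deriv ^^ Suc i) (\<lambda>w. M w $$ (u, s)) 0)))"
      using an by (intro sum.cong refl)
          (auto simp only: lessThan_iff * intro!: trans[OF higher_deriv_cmult'] analytic_intros)
    finally show ?thesis .
  qed
  also have "(\<Sum>u<n. minv (M 0) $$ (p, u) * (- ((deriv ^^ Suc i) (\<lambda>w. M w $$ (u, s)) 0)))
      / of_nat (Suc i) = nep_coeff M i $$ (p, s)"
    using ps M0 inv'
    by (simp add: nep_coeff_def mat_deriv_def scalar_prod_def atLeast0LessThan sum_divide_distrib
        flip: sum_negf del: funpow.simps of_nat_Suc)
  finally show ?thesis
    using ps M0 by (simp add: mat_deriv_def nep_B_def)
qed

text \<open>
  The primitive of a polynomial raises all exponents by one and vanishes at \<open>0\<close>, which makes room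
  for the series as the constant coefficient.
\<close>

lemma nep_op_poly:
  assumes "0 < \<rho>" and M: "mat_analytic_on n M (ball 0 \<rho>)" and inv: "invertible_mat (M 0)"
    and deg: "\<And>p. p < n \<Longrightarrow> degree (P p) \<le> k" and p: "p < n"
  shows "nep_op M (\<lambda>\<theta>. vec n (\<lambda>p. poly (P p) \<theta>)) \<theta> $ p =
    poly (pCons (\<Sum>i\<le>k. \<Sum>s<n. nep_coeff M i $$ (p, s) * coeff (P s) i)
      (\<Sum>i\<le>k. monom (coeff (P p) i / of_nat (Suc i)) i)) \<theta>"
proof -
  have M0: "M 0 \<in> carrier_mat n n" using M \<open>0 < \<rho>\<close> by (simp add: mat_analytic_on_def)
  define F where "F t = (\<Sum>i\<le>k. coeff (P p) i / of_nat (Suc i) * t ^ Suc i)" for t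
  have F': "(F has_field_derivative poly (P p) t) (at t)" for t
  proof -
    have "(F has_field_derivative (\<Sum>i\<le>k. coeff (P p) i / of_nat (Suc i) * (of_nat (Suc i) * t ^ i)))
        (at t)"
      unfolding F_def
      by (intro DERIV_sum DERIV_cmult) (rule derivative_eq_intros refl | simp)+
    moreover have "(\<Sum>i\<le>k. coeff (P p) i / of_nat (Suc i) * (of_nat (Suc i) * t ^ i))
        = (\<Sum>i\<le>k. coeff (P p) i * t ^ i)"
      by (intro sum.cong) (auto simp del: of_nat_Suc)
    moreover have "\<dots> = poly (P p) t"
      unfolding poly_altdef using deg[OF p] by (intro sum.mono_neutral_right) (auto simp: coeff_eq_0)
    ultimately show ?thesis by simp
  qed
  have "(poly (P p) has_contour_integral F (pathfinish (linepath 0 \<theta>))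
      - F (pathstart (linepath 0 \<theta>))) (linepath 0 \<theta>)"
    by (rule contour_integral_primitive[of UNIV]) (use F' in \<open>auto simp del: linepath_0\<close>)
  then have int: "contour_integral (linepath 0 \<theta>) (poly (P p)) = F \<theta>"
    unfolding pathstart_linepath pathfinish_linepath
      by (intro contour_integral_unique) (simp add: F_def)
  have dimB: "dim_row (nep_B M 0) = n" "dim_col (nep_B M 0) = n" using M0 by (auto simp: nep_B_def)
  have term_i: "(((1 / fact i) \<cdot>\<^sub>m mat_deriv i (nep_B M) 0) *\<^sub>v
        vec_deriv i (\<lambda>\<theta>. vec n (\<lambda>p. poly (P p) \<theta>)) 0) $ p
      = (\<Sum>s<n. nep_coeff M i $$ (p, s) * coeff (P s) i)" for i
  proof -
    have "(((1 / fact i) \<cdot>\<^sub>m mat_deriv i (nep_B M) 0) *\<^sub>v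
        vec_deriv i (\<lambda>\<theta>. vec n (\<lambda>p. poly (P p) \<theta>)) 0) $ p
      = (\<Sum>s<n. (1 / fact i) * mat_deriv i (nep_B M) 0 $$ (p, s) * (fact i * coeff (P s) i))"
      using p dimB by (simp add: vec_deriv_poly scalar_prod_def atLeast0LessThan mat_deriv_def)
    also have "\<dots> = (\<Sum>s<n. nep_coeff M i $$ (p, s) * coeff (P s) i)"
      by (intro sum.cong refl) (simp add: mat_deriv_nep_B[OF \<open>0 < \<rho>\<close> M inv p])
    finally show ?thesis .
  qed
  have "(\<Sum>i. \<Sum>s<n. nep_coeff M i $$ (p, s) * coeff (P s) i)
      = (\<Sum>i\<le>k. \<Sum>s<n. nep_coeff M i $$ (p, s) * coeff (P s) i)"
  proof (rule suminf_finite)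
    fix i assume "i \<notin> {..k}"
    then have "coeff (P s) i = 0" if "s < n" for s using deg[OF that] by (intro coeff_eq_0) auto
    then show "(\<Sum>s<n. nep_coeff M i $$ (p, s) * coeff (P s) i) = 0" by simp
  qed simp
  then show ?thesis
    using p M0 int
    by (simp add: nep_op_def term_i F_def poly_sum poly_monom sum_distrib_left mult_ac)
qed

lemma companion_carrier: "companion M N \<in> carrier_mat (N * dim_row (M 0)) (N * dim_row (M 0))"
  by (simp add: companion_def Let_def)

lemma index_companion_mult_vec:
  assumes M0: "M 0 \<in> carrier_mat n n" and x: "x \<in> carrier_vec ((k + 1) * n)"
    and i: "i \<le> k" and p: "p < n"
  shows "(companion M (k + 1) *\<^sub>v x) $ (i * n + p) =
    (if i = 0 then \<Sum>j\<le>k. \<Sum>s<n. nep_coeff M j $$ (p, s) * x $ (j * n + s)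
     else x $ ((i - 1) * n + p) / of_nat i)"
proof -
  note ip = block_index_less[OF i p]
  let ?C = "companion M (k + 1)"
  have C: "?C $$ (i * n + p, j * n + s) =
      (if i = 0 then nep_coeff M j $$ (p, s) else if j = i - 1 \<and> s = p then 1 / of_nat i else 0)"
          if "j \<le> k" "s < n" for j s
    using M0 ip block_index_less[OF that] p that
    by (auto simp: companion_def nep_coeff_def)
  have "(?C *\<^sub>v x) $ (i * n + p) = (\<Sum>t<(k + 1) * n. ?C $$ (i * n + p, t) * x $ t)"
    using ip x companion_carrier[of M "k + 1"] M0 by (simp add: scalar_prod_def atLeast0LessThan)
  also have "\<dots> = (\<Sum>j<k + 1. \<Sum>s<n. ?C $$ (i * n + p, j * n + s) * x $ (j * n + s))"
    by (rule sum_blocks)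
  also have "\<dots> = (\<Sum>j<k + 1. \<Sum>s<n. (if i = 0 then nep_coeff M j $$ (p, s)
      else if j = i - 1 \<and> s = p then 1 / of_nat i else 0) * x $ (j * n + s))"
    by (intro sum.cong refl) (simp add: C del: Suc_eq_plus1 add_Suc_right One_nat_def)
  finally have eq: "(?C *\<^sub>v x) $ (i * n + p) = (\<Sum>j\<le>k. \<Sum>s<n. (if i = 0 then nep_coeff M j $$ (p, s)
      else if j = i - 1 \<and> s = p then 1 / of_nat i else 0) * x $ (j * n + s))"
    by (simp only: Suc_eq_plus1 [symmetric] lessThan_Suc_atMost)
  show ?thesis
  proof (cases "i = 0")
    case False
    have "(\<Sum>s<n. (if i = 0 then nep_coeff M j $$ (p, s)
        else if j = i - 1 \<and> s = p then 1 / of_nat i else 0) * x $ (j * n + s))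
        = (if j = i - 1 then x $ (j * n + p) / of_nat i else 0)" for j
      using False p by (simp add: if_distrib if_distribR cong: if_cong)
    then show ?thesis using eq i False by simp
  qed (use eq in simp)
qed

lemma dim_first_cols: "dim_col (first_cols k A) = k"
  by (simp add: first_cols_def)

text \<open>
  Both sides of the factorization are polynomials in \<open>\<theta>\<close>, of formal degrees \<open>k + 1\<close> and \<open>k\<close>. The
  coefficients of \<open>\<theta>\<^sup>0, \<dots>, \<theta>\<^sup>k\<close> on the left are the blocks of the companion matrix applied to a
  column of coefficients.
\<close>

lemma companion_hessenberg:
  assumes "0 < \<rho>" and M: "mat_analytic_on n M (ball 0 \<rho>)" and inv: "invertible_mat (M 0)"
    and V: "V \<in> carrier_mat ((k + 1) * n) (k + 1)" and H: "H \<in> carrier_mat (k + 1) k"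
    and rel: "\<And>\<theta>. nep_op_cols M (\<lambda>t. first_cols k (monomial_mat n k t * V)) \<theta>
        = monomial_mat n k \<theta> * V * H"
    and j: "j < k"
  shows "companion M (k + 1) *\<^sub>v col V j = V *\<^sub>v col H j"
proof -
  have M0: "M 0 \<in> carrier_mat n n" using M \<open>0 < \<rho>\<close> by (simp add: mat_analytic_on_def)
  have VH: "V * H \<in> carrier_mat ((k + 1) * n) k" using V H by simp
  have mm: "monomial_mat n k \<theta> \<in> carrier_mat n ((k + 1) * n)" for \<theta>
    by (simp add: monomial_mat_def kron_def)
  let ?P = "entry_poly n k V j"
  let ?D = "\<lambda>p. \<Sum>i\<le>k. \<Sum>s<n. nep_coeff M i $$ (p, s) * coeff (?P s) i"
  have polys: "pCons (?D p) (\<Sum>i\<le>k. monom (coeff (?P p) i / of_nat (Suc i)) i)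
      = entry_poly n k (V * H) j p"
    if p: "p < n" for p
  proof -
    have "poly (pCons (?D p) (\<Sum>i\<le>k. monom (coeff (?P p) i / of_nat (Suc i)) i)) \<theta>
        = poly (entry_poly n k (V * H) j p) \<theta>" for \<theta>
    proof -
      have cols: "(\<lambda>t. col (first_cols k (monomial_mat n k t * V)) j) = (\<lambda>t. vec n (\<lambda>p. poly (?P p) t))"
      proof
        fix t
        have "col (first_cols k (monomial_mat n k t * V)) j = col (monomial_mat n k t * V) j"
          using j V by (intro eq_vecI) (auto simp: first_cols_def)
        then show "col (first_cols k (monomial_mat n k t * V)) j = vec n (\<lambda>p. poly (?P p) t)"
          using j by (simp add: col_monomial_mat_mult[OF V])
      qed
      have "nep_op_cols M (\<lambda>t. first_cols k (monomial_mat n k t * V)) \<theta> $$ (p, j)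
          = nep_op M (\<lambda>t. vec n (\<lambda>p. poly (?P p) t)) \<theta> $ p"
        using p j M0 by (simp add: nep_op_cols_def mat_of_cols_index cols dim_first_cols)
      also have "\<dots> = poly (pCons (?D p) (\<Sum>i\<le>k. monom (coeff (?P p) i / of_nat (Suc i)) i)) \<theta>"
        by (rule nep_op_poly[OF \<open>0 < \<rho>\<close> M inv degree_entry_poly p])
      finally have "poly (pCons (?D p) (\<Sum>i\<le>k. monom (coeff (?P p) i / of_nat (Suc i)) i)) \<theta>
          = (monomial_mat n k \<theta> * V * H) $$ (p, j)"
        by (simp add: rel)
      also have "\<dots> = col (monomial_mat n k \<theta> * (V * H)) j $ p"
        using p j mm[of \<theta>] V H by (simp add: assoc_mult_mat[OF mm V H])
      also have "\<dots> = poly (entry_poly n k (V * H) j p) \<theta>"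
        using p j by (simp add: col_monomial_mat_mult[OF VH])
      finally show ?thesis .
    qed
    then show ?thesis by (simp add: poly_eq_poly_eq_iff fun_eq_iff flip: poly_eq_poly_eq_iff)
  qed
  show ?thesis
  proof (rule eq_vecI)
    fix t assume "t < dim_vec (V *\<^sub>v col H j)"
    then have "t < (k + 1) * n" using V by simp
    then obtain i p where ip: "i \<le> k" "p < n" "t = i * n + p" by (rule block_index_cases)
    have colV: "col V j $ (i * n + p) = coeff (?P p) i" if "i \<le> k" "p < n" for i p
      using that block_index_less[OF that] j V by (simp add: coeff_entry_poly)
    have cV: "col V j \<in> carrier_vec ((k + 1) * n)" using V by (intro carrier_vecI) simp
    have "(companion M (k + 1) *\<^sub>v col V j) $ (i * n + p)
       = coeff (pCons (?D p) (\<Sum>i\<le>k. monom (coeff (?P p) i / of_nat (Suc i)) i)) i"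
      using ip V index_companion_mult_vec[where M = M and x = "col V j" and k = k and i = i
          and p = p, OF M0 cV ip(1,2)]
      by (cases i) (auto simp: colV coeff_sum intro!: sum.cong)
    also have "\<dots> = (V * H) $$ (i * n + p, j)"
      unfolding polys[OF ip(2)] using ip(1) by (simp add: coeff_entry_poly)
    finally show "(companion M (k + 1) *\<^sub>v col V j) $ t = (V *\<^sub>v col H j) $ t"
      using ip block_index_less[OF ip(1,2)] V H j by (simp add: index_mult_mat)
  qed (use V companion_carrier[of M "k + 1"] M0 in simp)
qed


section \<open>Orthonormal bases of Krylov spaces\<close>

lemma krylov_mat_carrier: "krylov_mat A v k \<in> carrier_mat (dim_vec v) (k + 1)"
  unfolding krylov_mat_def by (intro carrier_matI) simp_all

lemma pow_mat_Suc_mult_vec: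
  assumes "A \<in> carrier_mat m m" "v \<in> carrier_vec m"
  shows "(A ^\<^sub>m Suc j) *\<^sub>v v = A *\<^sub>v ((A ^\<^sub>m j) *\<^sub>v v)"
proof -
  have "A ^\<^sub>m Suc j = A * A ^\<^sub>m j"
    using assms(1) by (induction j) (auto simp: assoc_mult_mat[of _ m m _ m _ m])
  then show ?thesis using assms by (simp add: assoc_mult_mat_vec[of _ m m _ m])
qed

lemma col_krylov_mat:
  assumes "A \<in> carrier_mat m m" "v \<in> carrier_vec m" "j \<le> k"
  shows "col (krylov_mat A v k) j = (A ^\<^sub>m j) *\<^sub>v v"
proof -
  have "(A ^\<^sub>m j) *\<^sub>v v \<in> carrier_vec m"
    using assms by (intro mult_mat_vec_carrier[of _ m m] pow_carrier_mat)
  then show ?thesis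
    unfolding krylov_mat_def using assms
    by (subst col_mat_of_cols) (simp_all add: nth_append del: upt_Suc)
qed

lemma krylov_mat_step:
  assumes "A \<in> carrier_mat m m" "v \<in> carrier_vec m" "j < k"
  shows "A *\<^sub>v col (krylov_mat A v k) j = col (krylov_mat A v k) (Suc j)"
  using assms by (simp add: col_krylov_mat pow_mat_Suc_mult_vec del: pow_mat.simps)

text \<open>
  Column \<open>j + 1\<close> of \<open>V\<close> is a combination of \<open>C\<close> times column \<open>j\<close> and the columns up to \<open>j\<close>. If the latter are
  combinations of \<open>v, \<dots>, C\<^sup>j v\<close>, then applying \<open>C\<close> shifts the Krylov vectors and stays within
  \<open>v, \<dots>, C\<^sup>j\<^sup>+\<^sup>1 v\<close>. The induction therefore also keeps track of the triangular shape of the factor.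
\<close>

lemma hessenberg_krylov_factor:
  assumes C: "C \<in> carrier_mat m m" and V: "V \<in> carrier_mat m (k + 1)" and H: "H \<in> carrier_mat (k + 1) k"
    and hess: "upper_hessenberg H" and sub: "\<And>j. j < k \<Longrightarrow> H $$ (j + 1, j) \<noteq> 0"
    and rel: "\<And>j. j < k \<Longrightarrow> C *\<^sub>v col V j = V *\<^sub>v col H j"
  shows "\<exists>W\<in>carrier_mat (k + 1) (k + 1). V = krylov_mat C (col V 0) k * W"
proof -
  define K where "K = krylov_mat C (col V 0) k"
  have v: "col V 0 \<in> carrier_vec m" using V by (intro carrier_vecI) simp
  have K: "K \<in> carrier_mat m (k + 1)" using krylov_mat_carrier[of C "col V 0" k] V by (simp add: K_def)
  have ex: "\<exists>w. (\<forall>t<m. V $$ (t, j) = (\<Sum>l\<le>k. K $$ (t, l) * w l)) \<and> (\<forall>l>j. w l = 0)" if "j \<le> k" for j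
    using that
  proof (induction j rule: less_induct)
    case (less j)
    show ?case
    proof (cases j)
      case 0
      have "col K 0 = col V 0" using C one_mult_mat_vec[OF v] col_krylov_mat[OF C v, of 0 k]
        by (simp add: K_def)
      then have "V $$ (t, 0) = K $$ (t, 0)" if "t < m" for t
      proof -
        have "V $$ (t, 0) = col V 0 $ t" using that V by simp
        also have "\<dots> = col K 0 $ t" by (simp only: \<open>col K 0 = col V 0\<close>)
        also have "\<dots> = K $$ (t, 0)" using that K by simp
        finally show ?thesis .
      qed
      then show ?thesis using 0
        by (intro exI[of _ "\<lambda>l. if l = 0 then 1 else 0"]) (simp add: if_distrib cong: if_cong)
    next
      case (Suc i)
      then have ik: "i < k" using less.prems by simp
      have "\<forall>q\<in>{..i}. \<exists>w. (\<forall>t<m. V $$ (t, q) = (\<Sum>l\<le>k. K $$ (t, l) * w l)) \<and> (\<forall>l>q. w l = 0)"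
        using less Suc by auto
      from bchoice[OF this] obtain w where
        "\<forall>q\<in>{..i}. (\<forall>t<m. V $$ (t, q) = (\<Sum>l\<le>k. K $$ (t, l) * w q l)) \<and> (\<forall>l>q. w q l = 0)" by blast
      then have w: "\<And>q t. q \<le> i \<Longrightarrow> t < m \<Longrightarrow> V $$ (t, q) = (\<Sum>l\<le>k. K $$ (t, l) * w q l)"
        and w0: "\<And>q l. q \<le> i \<Longrightarrow> q < l \<Longrightarrow> w q l = 0"
        by auto
      \<comment> \<open>Krylov coordinates of \<open>C\<close> times column \<open>i\<close>, shifted by one; \<open>w'\<close> then solves the Arnoldi
        relation for column \<open>i + 1\<close>.\<close>
      define s where "s l = (case l of 0 \<Rightarrow> 0 | Suc l' \<Rightarrow> w i l')" for l
      define w' where "w' l = (s l - (\<Sum>q\<le>i. H $$ (q, i) * w q l)) / H $$ (i + 1, i)" for l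
      have "V $$ (t, j) = (\<Sum>l\<le>k. K $$ (t, l) * w' l)" if t: "t < m" for t
      proof -
        have shift: "(\<Sum>u<m. C $$ (t, u) * K $$ (u, l)) = K $$ (t, Suc l)" if "l < k" for l
          using arg_cong[OF krylov_mat_step[OF C v that], of "\<lambda>x :: complex vec. x $ t"] t that K C
          by (simp add: K_def[symmetric] scalar_prod_def atLeast0LessThan)
        have "(\<Sum>u<m. C $$ (t, u) * V $$ (u, i)) = (\<Sum>u<m. \<Sum>l\<le>k. C $$ (t, u) * K $$ (u, l) * w i l)"
          by (simp add: w sum_distrib_left mult.assoc)
        also have "\<dots> = (\<Sum>l\<le>k. (\<Sum>u<m. C $$ (t, u) * K $$ (u, l)) * w i l)"
          by (subst sum.swap) (simp add: sum_distrib_right)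
        also have "\<dots> = (\<Sum>l<k. (\<Sum>u<m. C $$ (t, u) * K $$ (u, l)) * w i l)"
          using w0[of i k] ik by (simp flip: lessThan_Suc_atMost)
        also have "\<dots> = (\<Sum>l<k. K $$ (t, Suc l) * s (Suc l))"
          by (simp add: shift s_def)
        also have "\<dots> = (\<Sum>l\<le>k. K $$ (t, l) * s l)"
          by (simp add: sum.lessThan_Suc_shift s_def flip: lessThan_Suc_atMost del: sum.lessThan_Suc)
        finally have "(\<Sum>l\<le>k. K $$ (t, l) * s l) = (\<Sum>q<k + 1. V $$ (t, q) * H $$ (q, i))"
          using arg_cong[OF rel[OF ik], of "\<lambda>x :: complex vec. x $ t"] t ik V C H
          by (simp add: scalar_prod_def atLeast0LessThan)
        also have "\<dots> = (\<Sum>q\<le>Suc i. V $$ (t, q) * H $$ (q, i))"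
          using hess ik H unfolding upper_hessenberg_def by (intro sum.mono_neutral_right) auto
        also have "\<dots> = (\<Sum>q\<le>i. V $$ (t, q) * H $$ (q, i)) + V $$ (t, j) * H $$ (i + 1, i)"
          by (simp add: Suc)
        also have "(\<Sum>q\<le>i. V $$ (t, q) * H $$ (q, i))
            = (\<Sum>q\<le>i. \<Sum>l\<le>k. K $$ (t, l) * (H $$ (q, i) * w q l))"
          using t by (simp add: w sum_distrib_left mult_ac)
        also have "\<dots> = (\<Sum>l\<le>k. K $$ (t, l) * (\<Sum>q\<le>i. H $$ (q, i) * w q l))"
          by (subst sum.swap) (simp add: sum_distrib_left)
        finally have "V $$ (t, j) * H $$ (i + 1, i)
            = (\<Sum>l\<le>k. K $$ (t, l) * (s l - (\<Sum>q\<le>i. H $$ (q, i) * w q l)))"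
          by (simp add: right_diff_distrib sum_subtractf)
        then show ?thesis
          using sub[OF ik] by (simp add: w'_def field_simps flip: sum_divide_distrib)
      qed
      moreover have "w' l = 0" if "l > j" for l
        using that Suc w0 by (auto simp: w'_def s_def split: nat.split)
      ultimately show ?thesis by blast
    qed
  qed
  then obtain w where w: "\<And>j t. j \<le> k \<Longrightarrow> t < m \<Longrightarrow> V $$ (t, j) = (\<Sum>l\<le>k. K $$ (t, l) * w j l)"
    by metis
  have "V = K * mat (k + 1) (k + 1) (\<lambda>(l, j). w j l)"
    using V K by (intro eq_matI) (auto simp: w scalar_prod_def atLeast0LessThan lessThan_Suc_atMost
        intro!: sum.cong)
  then show ?thesis unfolding K_def by (intro bexI) auto
qed

text \<open>
  The square matrix \<open>W\<close> has the left inverse \<open>(K W)\<^sup>H K\<close>, which is then also a right inverse, so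
  that \<open>x = W (K W)\<^sup>H K x\<close>.
\<close>

lemma mult_mat_inj_if_orthonormal_factor:
  assumes K: "K \<in> carrier_mat m N" and W: "W \<in> carrier_mat N N" and "orthonormal_cols (K * W)"
    and x: "x \<in> carrier_vec N" "K *\<^sub>v x = 0\<^sub>v m"
  shows "x = 0\<^sub>v N"
proof -
  define A where "A = mat_adjoint (K * W) * K"
  have adj: "mat_adjoint (K * W) \<in> carrier_mat N m"
    using K W by (intro mat_adjoint_carrier) simp
  then have A: "A \<in> carrier_mat N N" using K by (auto simp: A_def)
  have "A * W = 1\<^sub>m N"
    using assms(3) K W adj by (simp add: A_def orthonormal_cols_def assoc_mult_mat[OF adj K W])
  then have "W * A = 1\<^sub>m N" by (rule mat_mult_left_right_inverse[OF A W])
  moreover have "A *\<^sub>v x = 0\<^sub>v N"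
  proof -
    have zero: "X *\<^sub>v 0\<^sub>v m = 0\<^sub>v N" if "X \<in> carrier_mat N m" for X :: "complex mat"
      using that by (intro eq_vecI) auto
    have "A *\<^sub>v x = mat_adjoint (K * W) *\<^sub>v (K *\<^sub>v x)"
      unfolding A_def by (rule assoc_mult_mat_vec[OF adj K x(1)])
    also have "\<dots> = 0\<^sub>v N"
      unfolding x(2) by (rule zero[OF adj])
    finally show ?thesis .
  qed
  moreover have "W *\<^sub>v (A *\<^sub>v x) = (W * A) *\<^sub>v x"
    by (rule assoc_mult_mat_vec[OF W A x(1), symmetric])
  moreover have "W *\<^sub>v 0\<^sub>v N = 0\<^sub>v N" using W by (intro eq_vecI) auto
  ultimately show ?thesis using x by simp
qed


section \<open>Decay of the block rows\<close>

text \<open>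
  Passing from \<open>C\<^sup>j v\<close> to \<open>C\<^sup>j\<^sup>+\<^sup>1 v\<close> moves block \<open>i < k\<close> to block \<open>i + 1\<close> and divides it by \<open>i + 1\<close>.
  Following block \<open>i\<close> of \<open>C\<^sup>j v\<close> back, it started as block \<open>0\<close> of \<open>C\<^sup>j\<^sup>-\<^sup>i v\<close>, or, if \<open>j < i\<close>, as a
  block of \<open>v\<close> with positive index, which is zero.
\<close>

lemma krylov_block_entry:
  assumes M0: "M 0 \<in> carrier_mat n n"
    and v: "v \<in> carrier_vec ((k + 1) * n)"
    and const: "\<And>i p. 0 < i \<Longrightarrow> i \<le> k \<Longrightarrow> p < n \<Longrightarrow> v $ (i * n + p) = 0"
    and "i \<le> k" "j \<le> k" "p < n"
  shows "krylov_mat (companion M (k + 1)) v k $$ (i * n + p, j) =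
    (if j < i then 0 else krylov_mat (companion M (k + 1)) v k $$ (p, j - i) / fact i)"
proof -
  define K where "K = krylov_mat (companion M (k + 1)) v k"
  have C: "companion M (k + 1) \<in> carrier_mat ((k + 1) * n) ((k + 1) * n)"
    using companion_carrier[of M "k + 1"] M0 by simp
  have K: "K \<in> carrier_mat ((k + 1) * n) (k + 1)"
    using krylov_mat_carrier[of _ v k] v by (simp add: K_def)
  have entry: "K $$ (i * n + p, j) = col K j $ (i * n + p)" if "i \<le> k" "j \<le> k" "p < n" for i j p
    using K that block_index_less[OF that(1,3)] by simp
  have "K $$ (i * n + p, j) = (if j < i then 0 else K $$ (p, j - i) / fact i)"
    using \<open>i \<le> k\<close> \<open>j \<le> k\<close>
  proof (induction i arbitrary: j)
    case (Suc i)
    show ?case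
    proof (cases j)
      case 0
      have "col K 0 = v"
        using col_krylov_mat[OF C v, of 0 k] C one_mult_mat_vec[OF v] by (simp add: K_def)
      then show ?thesis using 0 Suc.prems const[of "Suc i" p] \<open>p < n\<close> entry[of "Suc i" 0 p] by simp
    next
      case (Suc j')
      have jk: "j' < k" using Suc \<open>j \<le> k\<close> by simp
      have cK: "col K j' \<in> carrier_vec ((k + 1) * n)" using K by (intro carrier_vecI) simp
      have "K $$ (Suc i * n + p, j) = col K (Suc j') $ (Suc i * n + p)"
        using entry[of "Suc i" j p] Suc Suc.prems \<open>p < n\<close> by simp
      also have "\<dots> = (companion M (k + 1) *\<^sub>v col K j') $ (Suc i * n + p)"
        using krylov_mat_step[OF C v jk] by (simp add: K_def)
      also have "\<dots> = col K j' $ (i * n + p) / of_nat (Suc i)"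
        using index_companion_mult_vec[where M = M, OF M0 cK Suc.prems(1) \<open>p < n\<close>] by simp
      also have "\<dots> = K $$ (i * n + p, j') / of_nat (Suc i)"
        using entry[of i j' p] Suc.prems \<open>p < n\<close> jk by simp
      also have "\<dots> = (if j' < i then 0 else K $$ (p, j' - i) / fact i) / of_nat (Suc i)"
        using Suc.IH[of j'] Suc.prems jk by simp
      finally show ?thesis using Suc by simp
    qed
  qed simp
  then show ?thesis by (simp add: K_def)
qed

definition block_row :: "nat \<Rightarrow> nat \<Rightarrow> complex mat \<Rightarrow> complex mat" where
  "block_row n i X = mat n (dim_col X) (\<lambda>(p, j). X $$ (i * n + p, j))"

lemma block_row_mult_vec:
  assumes "X \<in> carrier_mat ((k + 1) * n) N" "x \<in> carrier_vec N" "i \<le> k" "p < n"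
  shows "(block_row n i X *\<^sub>v x) $ p = (X *\<^sub>v x) $ (i * n + p)"
  using assms block_index_less[OF assms(3,4)]
  by (simp add: block_row_def scalar_prod_def atLeast0LessThan)

lemma vnorm_block_row_le:
  assumes X: "X \<in> carrier_mat ((k + 1) * n) N" and x: "x \<in> carrier_vec N" and "i \<le> k"
  shows "vnorm (block_row n i X *\<^sub>v x) \<le> vnorm (X *\<^sub>v x)"
proof (rule power2_le_imp_le)
  have "(vnorm (block_row n i X *\<^sub>v x))\<^sup>2 = (\<Sum>p<n. (cmod ((X *\<^sub>v x) $ (i * n + p)))\<^sup>2)"
    using block_row_mult_vec[OF X x \<open>i \<le> k\<close>] unfolding vnorm_sq
    by (intro sum.cong) (auto simp: block_row_def)
  also have "\<dots> \<le> (\<Sum>i<k + 1. \<Sum>p<n. (cmod ((X *\<^sub>v x) $ (i * n + p)))\<^sup>2)"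
    using \<open>i \<le> k\<close> by (intro member_le_sum[of i "{..<k + 1}"
        "\<lambda>i. \<Sum>p<n. (cmod ((X *\<^sub>v x) $ (i * n + p)))\<^sup>2"]) (auto intro: sum_nonneg)
  also have "\<dots> = (vnorm (X *\<^sub>v x))\<^sup>2"
    using X unfolding vnorm_sq by (subst sum_blocks [symmetric]) simp
  finally show "(vnorm (block_row n i X *\<^sub>v x))\<^sup>2 \<le> (vnorm (X *\<^sub>v x))\<^sup>2" .
qed (rule vnorm_nonneg)

text \<open>
  Shifting the columns of \<open>K\<^sub>0\<close> by \<open>i\<close> to the right has the same effect as shifting the argument \<open>i\<close>
  places down, which cannot increase its norm. What is left of \<open>K\<^sub>i\<close> is \<open>K\<^sub>0 / i!\<close>, and it is dominated by all of \<open>K\<close>.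
\<close>

lemma vnorm_krylov_block_row_le:
  assumes M0: "M 0 \<in> carrier_mat n n" and "0 < n"
    and v: "v \<in> carrier_vec ((k + 1) * n)"
    and const: "\<And>i p. 0 < i \<Longrightarrow> i \<le> k \<Longrightarrow> p < n \<Longrightarrow> v $ (i * n + p) = 0"
    and "i \<le> k" and K_def: "K = krylov_mat (companion M (k + 1)) v k"
    and inj: "\<And>x. x \<in> carrier_vec (k + 1) \<Longrightarrow> K *\<^sub>v x = 0\<^sub>v ((k + 1) * n) \<Longrightarrow> x = 0\<^sub>v (k + 1)"
    and z: "z \<in> carrier_vec (k + 1)"
  shows "vnorm (block_row n i K *\<^sub>v z) \<le> cond_number K / fact i * vnorm (K *\<^sub>v z)"
proof -
  have K: "K \<in> carrier_mat ((k + 1) * n) (k + 1)"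
    using krylov_mat_carrier[of _ v k] v by (simp add: K_def)
  define z' where "z' = vec (k + 1) (\<lambda>l. if l + i \<le> k then z $ (l + i) else 0)"
  have z': "z' \<in> carrier_vec (k + 1)" by (simp add: z'_def)
  have row: "block_row n i K *\<^sub>v z = (1 / fact i) \<cdot>\<^sub>v (block_row n 0 K *\<^sub>v z')"
  proof (rule eq_vecI)
    fix p assume "p < dim_vec ((1 / fact i) \<cdot>\<^sub>v (block_row n 0 K *\<^sub>v z'))"
    then have p: "p < n" by (simp add: block_row_def)
    have entry: "K $$ (i * n + p, j) = (if j < i then 0 else K $$ (p, j - i) / fact i)" if "j \<le> k" for j
      unfolding K_def by (rule krylov_block_entry[where M = M and v = v, OF M0 v const \<open>i \<le> k\<close> that p])
    have "(block_row n i K *\<^sub>v z) $ p = (\<Sum>j\<le>k. K $$ (i * n + p, j) * z $ j)"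
      using p K z by (simp add: block_row_def scalar_prod_def atLeast0LessThan lessThan_Suc_atMost)
    also have "\<dots> = (\<Sum>j\<le>k. if i \<le> j then K $$ (p, j - i) / fact i * z $ j else 0)"
      by (intro sum.cong refl) (simp add: entry)
    also have "\<dots> = (\<Sum>j\<in>{i..k}. K $$ (p, j - i) / fact i * z $ j)"
      by (intro sum.mono_neutral_cong_right) auto
    also have "\<dots> = (\<Sum>l\<in>{0..k - i}. K $$ (p, l) / fact i * z $ (l + i))"
      using \<open>i \<le> k\<close> sum.shift_bounds_cl_nat_ivl[of "\<lambda>j. K $$ (p, j - i) / fact i * z $ j" 0 i "k - i"]
      by simp
    also have "\<dots> = (\<Sum>l\<le>k. K $$ (p, l) / fact i * z' $ l)"
      using \<open>i \<le> k\<close> by (intro sum.mono_neutral_cong_left) (auto simp: z'_def)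
    also have "\<dots> = ((1 / fact i) \<cdot>\<^sub>v (block_row n 0 K *\<^sub>v z')) $ p"
      using p K z' by (simp add: block_row_def scalar_prod_def atLeast0LessThan lessThan_Suc_atMost
          sum_distrib_left sum_divide_distrib)
    finally show "(block_row n i K *\<^sub>v z) $ p = ((1 / fact i) \<cdot>\<^sub>v (block_row n 0 K *\<^sub>v z')) $ p" .
  qed (simp add: block_row_def)
  have "vnorm z' \<le> vnorm z"
  proof (rule power2_le_imp_le)
    have "(vnorm z')\<^sup>2 = (\<Sum>l\<in>{l. l + i \<le> k}. (cmod (z $ (l + i)))\<^sup>2)"
      unfolding vnorm_sq by (intro sum.mono_neutral_cong_right)
          (auto simp: z'_def intro: finite_subset[of _ "{..k}"])
    also have "\<dots> = (\<Sum>j\<in>(\<lambda>l. l + i) ` {l. l + i \<le> k}. (cmod (z $ j))\<^sup>2)"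
      by (subst sum.reindex) (auto simp: inj_on_def)
    also have "\<dots> \<le> (vnorm z)\<^sup>2"
      using z unfolding vnorm_sq by (intro sum_mono2) auto
    finally show "(vnorm z')\<^sup>2 \<le> (vnorm z)\<^sup>2" .
  qed (rule vnorm_nonneg)
  have "vnorm (block_row n i K *\<^sub>v z) = vnorm (block_row n 0 K *\<^sub>v z') / fact i"
    by (simp add: row vnorm_smult norm_divide)
  also have "\<dots> \<le> vnorm (K *\<^sub>v z') / fact i"
    using vnorm_block_row_le[OF K z', of 0] by (intro divide_right_mono) auto
  also have "\<dots> \<le> cond_number K * vnorm (K *\<^sub>v z) / fact i"
  proof (intro divide_right_mono cond_number_stretch_ratio[OF K _ _ inj z z' \<open>vnorm z' \<le> vnorm z\<close>])
    show "k + 1 \<le> (k + 1) * n" using \<open>0 < n\<close> by (cases n) auto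
  qed auto
  finally show ?thesis by simp
qed

lemma cauchy_schwarz_scalar_prod:
  assumes "x \<in> carrier_vec N" "y \<in> carrier_vec N"
  shows "cmod (x \<bullet> y) \<le> vnorm x * vnorm y"
proof -
  have "cmod (x \<bullet> y) \<le> (\<Sum>i<N. cmod (x $ i) * cmod (y $ i))"
    using assms by (auto simp: scalar_prod_def atLeast0LessThan norm_mult intro!: order_trans[OF
        norm_sum])
  also have "\<dots> \<le> vnorm x * vnorm y"
    using assms L2_set_mult_ineq[of "\<lambda>i. cmod (x $ i)" "\<lambda>i. cmod (y $ i)" "{..<N}"]
      by (simp add: vnorm_def)
  finally show ?thesis .
qed

text \<open>
  A matrix and its transpose have the same spectral norm: for the conjugate \<open>y\<close> of \<open>A x\<close> one has
  \<open>\<parallel>A x\<parallel>\<^sup>2 = x\<^sup>T (A\<^sup>T y) \<le> \<parallel>x\<parallel> c \<parallel>y\<parallel> = \<parallel>x\<parallel> c \<parallel>A x\<parallel>\<close>. A positive \<open>m\<close> forces \<open>c\<close> to be nonnegative.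
\<close>

lemma spectral_norm_le_of_transpose:
  assumes A: "A \<in> carrier_mat m N" and "0 < m"
    and bound: "\<And>y. y \<in> carrier_vec m \<Longrightarrow> vnorm (transpose_mat A *\<^sub>v y) \<le> c * vnorm y"
  shows "spectral_norm A \<le> c"
  unfolding spectral_norm_def
proof (rule cSUP_least)
  have "0 \<le> c * vnorm (unit_vec m 0)"
    using bound[of "unit_vec m 0"] vnorm_nonneg by (meson order_trans unit_vec_carrier)
  moreover have "0 < vnorm (unit_vec m 0)"
    using vnorm_eq_0_iff[of "unit_vec m 0" m] vnorm_nonneg[of "unit_vec m 0"] \<open>0 < m\<close> by fastforce
  ultimately have "0 \<le> c" by (simp add: zero_le_mult_iff)

  show "{x \<in> carrier_vec (dim_col A). vnorm x \<le> 1} \<noteq> {}"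
    using vnorm_eq_0_iff[of "0\<^sub>v N" N] A by (intro ex_in_conv[THEN iffD1] exI[of _ "0\<^sub>v N"]) auto
  fix x assume "x \<in> {x \<in> carrier_vec (dim_col A). vnorm x \<le> 1}"
  then have x: "x \<in> carrier_vec N" "vnorm x \<le> 1" using A by auto
  define y where "y = conjugate (A *\<^sub>v x)"
  have y: "y \<in> carrier_vec m" "vnorm y = vnorm (A *\<^sub>v x)" using A x
    by (auto simp: y_def vnorm_def intro!: L2_set_cong)
  have Ax: "A *\<^sub>v x \<in> carrier_vec m" and Ay: "transpose_mat A *\<^sub>v y \<in> carrier_vec N"
    using A x(1) y(1) by auto
  have "(A *\<^sub>v x) \<bullet>c (A *\<^sub>v x) = y \<bullet> (A *\<^sub>v x)"
    unfolding y_def using Ax by (intro comm_scalar_prod) auto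
  also have "\<dots> = x \<bullet> (transpose_mat A *\<^sub>v y)"
    unfolding transpose_vec_mult_scalar[OF A x(1) y(1), symmetric]
      by (rule comm_scalar_prod[OF Ay x(1)])
  finally have "cmod (complex_of_real ((vnorm y)\<^sup>2)) = cmod (x \<bullet> (transpose_mat A *\<^sub>v y))"
    unfolding y(2) cscalar_self by (rule arg_cong)
  then have "(vnorm y)\<^sup>2 = cmod (x \<bullet> (transpose_mat A *\<^sub>v y))"
    by (simp add: norm_power)
  also have "\<dots> \<le> vnorm x * vnorm (transpose_mat A *\<^sub>v y)"
    by (rule cauchy_schwarz_scalar_prod[OF x(1) Ay])
  also have "\<dots> \<le> 1 * (c * vnorm y)"
    using x(2) bound[OF y(1)] vnorm_nonneg by (intro mult_mono) auto
  finally have "vnorm y * vnorm y \<le> c * vnorm y" by (simp add: power2_eq_square)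
  then show "vnorm (A *\<^sub>v x) \<le> c"
    using \<open>0 \<le> c\<close> vnorm_nonneg[of y] y(2) by (cases "vnorm y = 0") auto
qed

theorem theorem9:
  fixes M :: "complex \<Rightarrow> complex mat" and Z H :: "complex mat"
    and a :: "nat \<Rightarrow> nat \<Rightarrow> nat \<Rightarrow> complex"
    and n r k :: nat and \<rho> :: real
  assumes "0 < \<rho>"
    and "mat_analytic_on n M (ball 0 \<rho>)"
    and "invertible_mat (M 0)"
    and "Z \<in> carrier_mat n r"
    and "orthonormal_cols Z"
    and "tiar_factorization M k (tensor_fun k Z a) H"
    and "\<exists>c. \<forall>\<theta>. col (tensor_fun k Z a \<theta>) 0 = c"
  shows "\<forall>i \<le> k. spectral_norm (slice_first k r a i)
           \<le> cond_number (krylov_mat (companion M (k + 1)) (tensor_start_vec k Z a) k) / fact i"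
proof (intro allI impI)
  fix i assume i: "i \<le> k"
  define V where "V = tensor_coeffs k Z a"
  define C where "C = companion M (k + 1)"
  define K where "K = krylov_mat C (col V 0) k"
  have Z: "dim_row Z = n" using assms(4) by simp
  have V: "V \<in> carrier_mat ((k + 1) * n) (k + 1)"
    using tensor_coeffs_carrier[of k Z a] Z by (simp add: V_def)
  have \<Psi>: "tensor_fun k Z a = (\<lambda>\<theta>. monomial_mat n k \<theta> * V)"
    by (simp add: tensor_fun_def [abs_def] Z V_def)
  have M0: "M 0 \<in> carrier_mat n n" using assms(1,2) by (simp add: mat_analytic_on_def)
  have C: "C \<in> carrier_mat ((k + 1) * n) ((k + 1) * n)"
    using companion_carrier[of M "k + 1"] M0 by (simp add: C_def)
  have v: "col V 0 \<in> carrier_vec ((k + 1) * n)" using V by (intro carrier_vecI) simp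
  have orth: "orthonormal_cols V"
    using assms(6) V by (intro orthonormal_coeffs) (auto simp: tiar_factorization_def \<Psi>)
  have "0 < n"
  proof (rule ccontr)
    assume "\<not> 0 < n"
    then have "dim_row V = 0" using V by simp
    then have "(mat_adjoint V * V) $$ (0, 0) = 0" using V by (simp add: scalar_prod_def)
    moreover have "(mat_adjoint V * V) $$ (0, 0) = 1"
      unfolding orth[unfolded orthonormal_cols_def] using V by simp
    ultimately show False by simp
  qed

  have H: "H \<in> carrier_mat (k + 1) k" "upper_hessenberg H"
    using assms(6) by (auto simp: tiar_factorization_def)
  have sub: "H $$ (j + 1, j) \<noteq> 0" if "j < k" for j
    using assms(6) that unfolding tiar_factorization_def by force
  have rel: "C *\<^sub>v col V j = V *\<^sub>v col H j" if "j < k" for j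
    unfolding C_def
  proof (rule companion_hessenberg[OF assms(1-3) V H(1) _ that])
    show "nep_op_cols M (\<lambda>t. first_cols k (monomial_mat n k t * V)) \<theta> = monomial_mat n k \<theta> * V * H"
        for \<theta>
      using assms(6) by (simp add: tiar_factorization_def \<Psi>)
  qed
  obtain W where W: "W \<in> carrier_mat (k + 1) (k + 1)" "V = K * W"
    using hessenberg_krylov_factor[OF C V H sub rel] by (auto simp: K_def)

  have const: "col V 0 $ (b * n + p) = 0" if "0 < b" "b \<le> k" "p < n" for b p
  proof -
    obtain c where c: "\<And>\<theta>. col (tensor_fun k Z a \<theta>) 0 = c" using assms(7) by blast
    have "poly (entry_poly n k V 0 p) \<theta> = poly [:c $ p:] \<theta>" for \<theta>
      using arg_cong[OF c[of \<theta>], of "\<lambda>x :: complex vec. x $ p"] that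
      by (simp add: \<Psi> col_monomial_mat_mult[OF V] del: index_col)
    then have "entry_poly n k V 0 p = [:c $ p:]"
      by (intro poly_eq_poly_eq_iff[THEN iffD1] ext)
    from arg_cong[OF this, of "\<lambda>P. coeff P b"] that show ?thesis
      using V block_index_less[OF that(2,3)] by (cases b) (auto simp: coeff_entry_poly)
  qed
  have K: "K \<in> carrier_mat ((k + 1) * n) (k + 1)"
    using krylov_mat_carrier[of C "col V 0" k] V by (simp add: K_def)
  have inj: "x = 0\<^sub>v (k + 1)" if "x \<in> carrier_vec (k + 1)" "K *\<^sub>v x = 0\<^sub>v ((k + 1) * n)" for x
    using mult_mat_inj_if_orthonormal_factor[OF K W(1) _ that] orth W(2) by simp

  have "spectral_norm (slice_first k r a i) \<le> cond_number K / fact i"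
  proof (rule spectral_norm_le_of_transpose)
    show "slice_first k r a i \<in> carrier_mat (k + 1) r" by (simp add: slice_first_def)
    fix y :: "complex vec" assume y: "y \<in> carrier_vec (k + 1)"
    have Wy: "W *\<^sub>v y \<in> carrier_vec (k + 1)" using W y by simp
    have Ty: "transpose_mat (slice_first k r a i) *\<^sub>v y \<in> carrier_vec r"
      unfolding slice_first_def by (rule mult_mat_vec_carrier[OF _ y]) simp
    have "Z *\<^sub>v (transpose_mat (slice_first k r a i) *\<^sub>v y) = block_row n i V *\<^sub>v y"
    proof -
      have "Z * transpose_mat (slice_first k r a i) = block_row n i V"
        using assms(4) V i
        by (intro eq_matI)
           (auto simp: block_row_def slice_first_def V_def index_tensor_coeffs[OF assms(4)]
              scalar_prod_def atLeast0LessThan mult.commute)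
      then show ?thesis
        using assms(4) y assoc_mult_mat_vec[OF assms(4), of "transpose_mat (slice_first k r a i)"
            "k + 1" y]
        by (simp add: slice_first_def)
    qed
    then have "vnorm (transpose_mat (slice_first k r a i) *\<^sub>v y) = vnorm (block_row n i V *\<^sub>v y)"
      using vnorm_isometry[OF assms(5,4) Ty] by simp
    also have "block_row n i V *\<^sub>v y = block_row n i K *\<^sub>v (W *\<^sub>v y)"
    proof (rule eq_vecI)
      fix p assume "p < dim_vec (block_row n i K *\<^sub>v (W *\<^sub>v y))"
      then have p: "p < n" by (simp add: block_row_def)
      show "(block_row n i V *\<^sub>v y) $ p = (block_row n i K *\<^sub>v (W *\<^sub>v y)) $ p"
        unfolding block_row_mult_vec[OF V y i p] block_row_mult_vec[OF K Wy i p]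
        by (simp add: W(2) assoc_mult_mat_vec[OF K W(1) y])
    qed (simp add: block_row_def)
    also have "vnorm \<dots> \<le> cond_number K / fact i * vnorm (K *\<^sub>v (W *\<^sub>v y))"
      using vnorm_krylov_block_row_le[where M = M, OF M0 \<open>0 < n\<close> v const i _ inj Wy]
        by (simp add: K_def C_def)
    also have "K *\<^sub>v (W *\<^sub>v y) = V *\<^sub>v y"
      by (simp add: W(2) assoc_mult_mat_vec[OF K W(1) y])
    also have "vnorm (V *\<^sub>v y) = vnorm y" by (rule vnorm_isometry[OF orth V y])
    finally show "vnorm (transpose_mat (slice_first k r a i) *\<^sub>v y)
        \<le> cond_number K / fact i * vnorm y" .
  qed simp
  then show "spectral_norm (slice_first k r a i)
      \<le> cond_number (krylov_mat (companion M (k + 1)) (tensor_start_vec k Z a) k) / fact i"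
    by (simp add: K_def C_def V_def tensor_start_vec_eq_col)
qed

end
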